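(* Let $\mathbb{A}=\mathbb{R}$ or $\mathbb{C}$. (i) Let $F:\mathbb{A}^n\to\mathbb{A}^n$ be a $C^1$ real semi-algebraic mapping such that $\operatorname{Sing}F=\emptyset$. If $K_\infty(F)=\emptyset$, then $F$ is a global diffeomorphism. (ii) In particular, if $F=(f_1,\ldots,f_n):\mathbb{A}^n\to\mathbb{A}^n$ is a real, or a mixed, or a complex polynomial mapping with $F(0)=0$ and $\operatorname{Sing}F=\emptyset$, which is non-degenerate at infinity, and if $f_i$ is convenient for all $i=1,\ldots,n$, then $F$ is a global diffeomorphism.
   Context: **Mappings.** A polynomial mapping $F=(f_1,\ldots,f_k):\mathbb{A}^n\to\mathbb{A}^k$ (here $k=n$) is of one of three types: real ($\mathbb{A}=\mathbb{R}$, $f_j$ real polynomials), complex ($\mathbb{A}=\mathbb{C}$, $f_j$ complex polynomials in $z$), or mixed ($\mathbb{A}=\mathbb{C}$, $f_j$ polynomials in $z$ and $\bar z$ with complex coefficients). $\mathbb{A}^*=\mathbb{A}\setminus\{0\}$. For a map, $\operatorname{Sing}$ denotes the set of points where the differential is not surjective; for mixed maps, and for $C^1$ real semi-algebraic maps with $\mathbb{A}=\mathbb{C}$, this is the real differential of the underlying real map ($\mathbb{C}=\mathbb{R}^2$). **Asymptotic critical values.** For a $C^1$ real semi-algebraic map $F:\mathbb{A}^n\to\mathbb{A}^k$, $K_\infty(F)$ is the set of $c\in\mathbb{A}^k$ for which there is a sequence $\{x_l\}_{l\in\mathbb{N}}\subset\mathbb{A}^n$ with $\|x_l\|\to\infty$,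 $F(x_l)\to c$ and $(1+\|x_l\|)\,\nu(dF(x_l))\to 0$, where $\nu(B)=\inf_{\|\varphi\|=1}\|B^*(\varphi)\|$ for a linear map $B$ with adjoint $B^*$ (when $\mathbb{A}=\mathbb{C}$ and $F$ is not holomorphic, $dF$ is the real differential of the underlying real map). **Supports, convenience, Newton polyhedra.** For $f(x)=\sum_\nu c_\nu x^\nu$ put $\operatorname{supp}(f)=\{\nu\in\mathbb{N}^n: c_\nu\ne0\}$; for mixed $f(z,\bar z)=\sum_{\nu,\mu}c_{\nu,\mu}z^\nu\bar z^\mu$ put $\operatorname{supp}(f)=\{\nu+\mu: c_{\nu,\mu}\neq0\}$. When $f(0)=0$, $f$ is *convenient* if $\operatorname{supp}(f)$ meets every coordinate axis, and $\Gamma_0(f)$ is the convex hull of $\{0\}\cup\operatorname{supp}(f)$. For a face $\Delta$ (of any dimension), $f_\Delta=\sum_{\nu\in\Delta\cap\operatorname{supp}(f)}c_\nu x^\nu$, resp. $f_\Delta=\sum_{\nu+\mu\in\Delta\cap\operatorname{supp}(f)}c_{\nu,\mu}z^\nu\bar z^\mu$ in the mixed case. **Dual subdivision.** For $\mathbf{p}=(p_1,\ldots,p_n)\in\mathbb{Z}^n$ with $\min_i p_i<0$, let $l_{\mathbf{p}}(v)=\sum_i p_iv_i$ and let $\Delta^j_{\mathbf{p}}$ be the maximal face of $\Gamma_0(f_j)$ on which $l_{\mathbf{p}}$ attains its minimum over $\Gamma_0(f_j)$. Declare $\mathbf{p}\sim\mathbf{p}'$ iff $\Delta^j_{\mathbf{p}}=\Delta^j_{\mathbf{p}'}$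 for all $1\le j\le k$. The equivalence classes give a partition of $\mathbb{R}^n\setminus\mathbb{R}^n_+$ (where $\mathbb{R}_+^n$ is the set of vectors with all coordinates $\ge 0$) into finitely many locally closed cones; each is subdivided into finitely many convex polyhedral cones, and $\mathcal{C}(F)$ is the finite set of cones obtained. For $\sigma\in\mathcal{C}(F)$, write $\Delta^j_\sigma:=\Delta^j_{\mathbf{p}}$ for any $\mathbf{p}\in\sigma$ (independent of $\mathbf{p}$), and $$I_\sigma=\{j: 0\notin\Delta^j_\sigma\},\quad J_\sigma=\{j:\Delta^j_\sigma=\{0\}\},$$ $$G_\sigma=\{x\in(\mathbb{A}^* )^n: f_{\Delta^j_\sigma}(x)=0\ \text{for all } j\in I_\sigma\},$$ where $f_{\Delta^j_\sigma}$ stands for $(f_j)_{\Delta^j_\sigma}$. **Non-degeneracy at infinity.** $F$ (with $F(0)=0$) is *non-degenerate at infinity* if for every $\sigma\in\mathcal{C}(F)$ with $I_\sigma\neq\emptyset$ and $J_\sigma=\emptyset$, one has $\operatorname{Sing}\,(f_{\Delta^j_\sigma})_{j\in I_\sigma}\cap G_\sigma=\emptyset$. *)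

theory Defs
  imports "HOL-Analysis.Analysis" "HOL-Library.Poly_Mapping" "HOL-Library.Disjoint_Sets"
begin

text \<open>
  The spaces \<open>A\<^sup>n\<close> are \<open>real^'n\<close> and \<open>complex^'n\<close>. Derivatives are always taken over the reals, with
  \<open>complex^'n\<close> in its Euclidean structure. For a holomorphic map the real derivative and the complex
  derivative are the same function, with the same image and the same adjoint (the adjoint for the
  Hermitian product is also the adjoint for its real part), so one definition serves all cases.
\<close>

inductive semialgebraic :: "'a::euclidean_space set \<Rightarrow> bool" where
  pos: "real_polynomial_function p \<Longrightarrow> semialgebraic {x. p x > 0}"
| Int: "semialgebraic S \<Longrightarrow> semialgebraic T \<Longrightarrow> semialgebraic (S \<inter> T)"
| Un: "semialgebraic S \<Longrightarrow> semialgebraic T \<Longrightarrow> semialgebraic (S \<union> T)"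
| Compl: "semialgebraic S \<Longrightarrow> semialgebraic (- S)"

definition semialgebraic_map :: "('a::euclidean_space \<Rightarrow> 'b::euclidean_space) \<Rightarrow> bool" where
  "semialgebraic_map F \<longleftrightarrow> semialgebraic {(x, y). y = F x}"

definition C1_map :: "('a::euclidean_space \<Rightarrow> 'b::euclidean_space) \<Rightarrow> bool" where
  "C1_map F \<longleftrightarrow>
     (\<exists>F' :: 'a \<Rightarrow> 'a \<Rightarrow>\<^sub>L 'b.
        (\<forall>x. (F has_derivative blinfun_apply (F' x)) (at x)) \<and> continuous_on UNIV F')"

definition global_diffeomorphism :: "('a::euclidean_space \<Rightarrow> 'a) \<Rightarrow> bool" where
  "global_diffeomorphism F \<longleftrightarrow> bij F \<and> C1_map F \<and> C1_map (inv F)"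

definition Sing :: "('a::euclidean_space \<Rightarrow> 'b::euclidean_space) \<Rightarrow> 'a set" where
  "Sing F = {x. \<not> surj (frechet_derivative F (at x))}"

definition rabier_nu :: "('a::euclidean_space \<Rightarrow> 'b::euclidean_space) \<Rightarrow> real" where
  "rabier_nu B = (INF \<phi>\<in>sphere 0 1. norm (adjoint B \<phi>))"

definition K_infinity :: "('a::euclidean_space \<Rightarrow> 'b::euclidean_space) \<Rightarrow> 'b set" where
  "K_infinity F =
     {c. \<exists>x :: nat \<Rightarrow> 'a.
           filterlim (\<lambda>l. norm (x l)) at_top sequentially \<and>
           (\<lambda>l. F (x l)) \<longlonglongrightarrow> c \<and>
           (\<lambda>l. (1 + norm (x l)) * rabier_nu (frechet_derivative F (at (x l)))) \<longlonglongrightarrow> 0}"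

text \<open>
  A polynomial is its finitely supported family of coefficients, indexed by exponents \<open>\<nu>\<close>, or by
  pairs \<open>(\<nu>, \<mu>)\<close> of exponents of \<open>z\<close> and of its conjugate in the mixed case.
\<close>

type_synonym ('a, 'n) polynomial = "(nat ^ 'n) \<Rightarrow>\<^sub>0 'a"
type_synonym 'n mixed_polynomial = "((nat ^ 'n) \<times> (nat ^ 'n)) \<Rightarrow>\<^sub>0 complex"

definition vec_power :: "'a::comm_monoid_mult ^ 'n \<Rightarrow> nat ^ 'n \<Rightarrow> 'a" where
  "vec_power x \<nu> = (\<Prod>i\<in>UNIV. (x $ i) ^ (\<nu> $ i))"

definition cnj_vec :: "complex ^ 'n \<Rightarrow> complex ^ 'n" where
  "cnj_vec z = (\<chi> i. cnj (z $ i))"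

definition real_vec :: "nat ^ 'n \<Rightarrow> real ^ 'n" where
  "real_vec \<nu> = (\<chi> i. real (\<nu> $ i))"

definition poly_supp :: "('a::zero, 'n) polynomial \<Rightarrow> (nat ^ 'n) set" where
  "poly_supp f = {\<nu>. Poly_Mapping.lookup f \<nu> \<noteq> 0}"

definition mixed_supp :: "'n mixed_polynomial \<Rightarrow> (nat ^ 'n) set" where
  "mixed_supp f = {\<nu> + \<mu> | \<nu> \<mu>. Poly_Mapping.lookup f (\<nu>, \<mu>) \<noteq> 0}"

definition poly_eval :: "('a::comm_semiring_1, 'n) polynomial \<Rightarrow> 'a ^ 'n \<Rightarrow> 'a" where
  "poly_eval f x = (\<Sum>\<nu>\<in>Poly_Mapping.keys f. Poly_Mapping.lookup f \<nu> * vec_power x \<nu>)"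

definition mixed_eval :: "'n mixed_polynomial \<Rightarrow> complex ^ 'n \<Rightarrow> complex" where
  "mixed_eval f z =
     (\<Sum>(\<nu>, \<mu>)\<in>Poly_Mapping.keys f.
        Poly_Mapping.lookup f (\<nu>, \<mu>) * vec_power z \<nu> * vec_power (cnj_vec z) \<mu>)"

definition poly_map :: "('n \<Rightarrow> ('a::comm_semiring_1, 'n) polynomial) \<Rightarrow> 'a ^ 'n \<Rightarrow> 'a ^ 'n" where
  "poly_map f x = (\<chi> j. poly_eval (f j) x)"

definition mixed_map :: "('n \<Rightarrow> 'n mixed_polynomial) \<Rightarrow> complex ^ 'n \<Rightarrow> complex ^ 'n" where
  "mixed_map f z = (\<chi> j. mixed_eval (f j) z)"

definition poly_face ::
  "('a::comm_semiring_1, 'n) polynomial \<Rightarrow> (real ^ 'n) set \<Rightarrow> 'a ^ 'n \<Rightarrow> 'a" where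
  "poly_face f \<Delta> x =
     (\<Sum>\<nu>\<in>{\<nu> \<in> Poly_Mapping.keys f. real_vec \<nu> \<in> \<Delta>}. Poly_Mapping.lookup f \<nu> * vec_power x \<nu>)"

definition mixed_face ::
  "'n mixed_polynomial \<Rightarrow> (real ^ 'n) set \<Rightarrow> complex ^ 'n \<Rightarrow> complex" where
  "mixed_face f \<Delta> z =
     (\<Sum>(\<nu>, \<mu>)\<in>{(\<nu>, \<mu>) \<in> Poly_Mapping.keys f. real_vec (\<nu> + \<mu>) \<in> \<Delta>}.
        Poly_Mapping.lookup f (\<nu>, \<mu>) * vec_power z \<nu> * vec_power (cnj_vec z) \<mu>)"

text \<open>
  The combinatorial notions depend only on supports. \<open>S\<close> stands for the support of a polynomial, or
  for the family of supports of the components of a map.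
\<close>

definition coordinate_axis :: "'n \<Rightarrow> (nat ^ 'n) set" where
  "coordinate_axis i = {\<nu>. \<forall>k. k \<noteq> i \<longrightarrow> \<nu> $ k = 0}"

definition convenient :: "(nat ^ 'n) set \<Rightarrow> bool" where
  "convenient S \<longleftrightarrow> (\<forall>i. S \<inter> coordinate_axis i \<noteq> {})"

definition Gamma0 :: "(nat ^ 'n) set \<Rightarrow> (real ^ 'n) set" where
  "Gamma0 S = convex hull (insert 0 (real_vec ` S))"

definition min_face :: "(nat ^ 'n) set \<Rightarrow> real ^ 'n \<Rightarrow> (real ^ 'n) set" where
  "min_face S p = {v \<in> Gamma0 S. \<forall>w \<in> Gamma0 S. p \<bullet> v \<le> p \<bullet> w}"

text \<open>
  The covectors range over the real vectors outside the nonnegative orthant, since it is this set that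
  the equivalence classes partition. Every class is a relatively open rational cone minus the closed
  orthant, so it contains integer vectors, and no class is added or lost with respect to integer ones.
\<close>

definition dual_domain :: "(real ^ 'n) set" where
  "dual_domain = UNIV - {p. \<forall>i. p $ i \<ge> 0}"

definition face_equiv :: "('n \<Rightarrow> (nat ^ 'n) set) \<Rightarrow> ((real ^ 'n) \<times> (real ^ 'n)) set" where
  "face_equiv S =
     {(p, p'). p \<in> dual_domain \<and> p' \<in> dual_domain \<and> (\<forall>j. min_face (S j) p = min_face (S j) p')}"

text \<open>
  The cones of a partition cannot all be closed, so strict inequalities are allowed.
\<close>

definition convex_polyhedral_cone :: "'a::euclidean_space set \<Rightarrow> bool" where
  "convex_polyhedral_cone \<sigma> \<longleftrightarrow>
     (\<exists>A B. finite A \<and> finite B \<and> \<sigma> = {p. (\<forall>a\<in>A. a \<bullet> p \<le> 0) \<and> (\<forall>b\<in>B. b \<bullet> p < 0)})"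

text \<open>
  The subdivision of the equivalence classes into convex cones is a choice, so this is a
  predicate on the set \<open>C\<close> of cones obtained.
\<close>

definition dual_subdivision :: "('n \<Rightarrow> (nat ^ 'n) set) \<Rightarrow> (real ^ 'n) set set \<Rightarrow> bool" where
  "dual_subdivision S C \<longleftrightarrow>
     finite C \<and> (\<forall>\<sigma>\<in>C. convex_polyhedral_cone \<sigma>) \<and>
     refines dual_domain C (dual_domain // face_equiv S)"

definition cone_face :: "(nat ^ 'n) set \<Rightarrow> (real ^ 'n) set \<Rightarrow> (real ^ 'n) set" where
  "cone_face S \<sigma> = min_face S (SOME p. p \<in> \<sigma>)"

definition I_cone :: "('n \<Rightarrow> (nat ^ 'n) set) \<Rightarrow> (real ^ 'n) set \<Rightarrow> 'n set" where
  "I_cone S \<sigma> = {j. 0 \<notin> cone_face (S j) \<sigma>}"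

definition J_cone :: "('n \<Rightarrow> (nat ^ 'n) set) \<Rightarrow> (real ^ 'n) set \<Rightarrow> 'n set" where
  "J_cone S \<sigma> = {j. cone_face (S j) \<sigma> = {0}}"

text \<open>
  The singular points of a map \<open>(g\<^sub>j)\<close> with \<open>j\<close> in \<open>I\<close>, whose target, the product of copies of
  \<open>'b\<close> indexed by \<open>I\<close>, is the extensional function space \<open>I \<rightarrow>\<^sub>E UNIV\<close>.
\<close>

definition Sing_family ::
  "'i set \<Rightarrow> ('i \<Rightarrow> 'a::euclidean_space \<Rightarrow> 'b::euclidean_space) \<Rightarrow> 'a set" where
  "Sing_family I g =
     {x. range (\<lambda>v. \<lambda>j\<in>I. frechet_derivative (g j) (at x) v) \<noteq> (I \<rightarrow>\<^sub>E UNIV)}"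

text \<open>
  \<open>S j\<close> is the support of the \<open>j\<close>-th component and \<open>fc j \<Delta>\<close> is its restriction to the face \<open>\<Delta>\<close>.
\<close>

definition G_cone ::
  "('n \<Rightarrow> (nat ^ 'n) set) \<Rightarrow> ('n \<Rightarrow> (real ^ 'n) set \<Rightarrow> 'a::zero ^ 'n \<Rightarrow> 'a) \<Rightarrow>
   (real ^ 'n) set \<Rightarrow> ('a ^ 'n) set" where
  "G_cone S fc \<sigma> =
     {x. (\<forall>i. x $ i \<noteq> 0) \<and> (\<forall>j\<in>I_cone S \<sigma>. fc j (cone_face (S j) \<sigma>) x = 0)}"

definition nondegenerate_at_infinity ::
  "(real ^ 'n) set set \<Rightarrow> ('n \<Rightarrow> (nat ^ 'n) set) \<Rightarrow>
   ('n \<Rightarrow> (real ^ 'n) set \<Rightarrow> 'a::euclidean_space ^ 'n \<Rightarrow> 'a) \<Rightarrow> bool" where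
  "nondegenerate_at_infinity C S fc \<longleftrightarrow>
     (\<forall>\<sigma>\<in>C. I_cone S \<sigma> \<noteq> {} \<and> J_cone S \<sigma> = {} \<longrightarrow>
        Sing_family (I_cone S \<sigma>) (\<lambda>j. fc j (cone_face (S j) \<sigma>)) \<inter> G_cone S fc \<sigma> = {})"

definition poly_nondegenerate_at_infinity ::
  "(real ^ 'n) set set \<Rightarrow> ('n \<Rightarrow> ('a::{euclidean_space, comm_semiring_1}, 'n) polynomial) \<Rightarrow> bool" where
  "poly_nondegenerate_at_infinity C f \<longleftrightarrow>
     nondegenerate_at_infinity C (\<lambda>j. poly_supp (f j)) (\<lambda>j. poly_face (f j))"

definition mixed_nondegenerate_at_infinity ::
  "(real ^ 'n) set set \<Rightarrow> ('n \<Rightarrow> 'n mixed_polynomial) \<Rightarrow> bool" where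
  "mixed_nondegenerate_at_infinity C f \<longleftrightarrow>
     nondegenerate_at_infinity C (\<lambda>j. mixed_supp (f j)) (\<lambda>j. mixed_face (f j))"

end

theory Submission
  imports Defs
begin

text \<open>
  If \<open>K_infinity F\<close> is empty, then locally over the target \<open>\<parallel>dF(x)\<^sup>-\<^sup>1\<parallel> \<le> C (1 + \<parallel>x\<parallel>)\<close>, so lifts of
  segments grow at most exponentially and extend to the end of the segment. Lifting all segments from
  \<open>F x\<close> gives a global continuous section \<open>G\<close> of the local diffeomorphism \<open>F\<close>, and \<open>G \<circ> F\<close> is the
  identity because lifts are unique.

  A convenient polynomial map that is nondegenerate at infinity is even proper. Along a sequence
  \<open>x\<^sub>l\<close> going to infinity with bounded values, the dominant terms of the components are those of the
  faces selected by a covector \<open>p\<close> close to \<open>- ln \<bar>x\<^sub>l\<bar>\<close>, and a rescaled subsequence converges to a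
  common zero \<open>a\<close> of these face polynomials in the torus. By convenience all components take part in the
  nondegeneracy condition, so their differentials are independent at \<open>a\<close>; but by Euler's relation
  they all vanish on the vector \<open>(p\<^sub>i a\<^sub>i)\<close>.
\<close>

section \<open>The Rabier number\<close>

lemma rabier_nu_nonneg: "0 \<le> rabier_nu (B :: 'a::euclidean_space \<Rightarrow> 'b::euclidean_space)"
proof -
  have "sphere (0::'b) 1 \<noteq> {}" by simp
  then show ?thesis
    unfolding rabier_nu_def by (intro cINF_greatest) auto
qed

lemma rabier_nu_le:
  fixes B :: "'a::euclidean_space \<Rightarrow> 'b::euclidean_space"
  assumes "linear B"
  shows "rabier_nu B * norm \<phi> \<le> norm (adjoint B \<phi>)"
proof (cases "\<phi> = 0")
  case False
  define u where "u = \<phi> /\<^sub>R norm \<phi>"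
  have "rabier_nu B \<le> norm (adjoint B u)"
    unfolding rabier_nu_def
    using False by (intro cINF_lower bdd_belowI2[where m = 0]) (auto simp: u_def)
  also have "\<dots> = norm (adjoint B \<phi>) / norm \<phi>"
    by (simp add: u_def linear_cmul[OF adjoint_linear[OF assms]] divide_inverse_commute)
  finally show ?thesis
    using False by (simp add: field_simps)
qed simp

text \<open>In equal dimensions the adjoint of a surjection is onto, so \<open>v\<close> is the
  adjoint image of some \<open>\<phi>\<close>. Then \<open>norm v\<close> squared equals
  \<open>B v \<bullet> \<phi>\<close>, and \<open>\<phi>\<close> is controlled by
  \<open>rabier_nu_le\<close>. In other words, the inverse of \<open>B\<close> has norm at most
  \<open>1 / rabier_nu B\<close> when this number is positive.\<close>

lemma rabier_nu_mult_norm_le: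
  fixes B :: "'a::euclidean_space \<Rightarrow> 'a"
  assumes B: "linear B" and "surj B"
  shows "rabier_nu B * norm v \<le> norm (B v)"
proof -
  have lin: "linear (adjoint B)"
    using B by (rule adjoint_linear)
  have "inj (adjoint B)"
    unfolding linear_injective_0[OF lin]
  proof (intro allI impI)
    fix \<phi> assume 0: "adjoint B \<phi> = 0"
    obtain x where "B x = \<phi>"
      using \<open>surj B\<close> by (metis surjD)
    then have "\<phi> \<bullet> \<phi> = x \<bullet> adjoint B \<phi>"
      by (simp add: adjoint_works[OF B])
    then show "\<phi> = 0"
      using 0 by simp
  qed
  then have "surj (adjoint B)"
    using lin linear_injective_imp_surjective by blast
  then obtain \<phi> where \<phi>: "adjoint B \<phi> = v"
    by (metis surjD)
  show ?thesis
  proof (cases "v = 0")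
    case False
    have "norm v * norm v = B v \<bullet> \<phi>"
      using \<phi> by (simp flip: adjoint_works[OF B] power2_norm_eq_inner add: power2_eq_square)
    also have "\<dots> \<le> norm (B v) * norm \<phi>"
      by (rule norm_cauchy_schwarz)
    finally have "rabier_nu B * (norm v * norm v) \<le> norm (B v) * (rabier_nu B * norm \<phi>)"
      using rabier_nu_nonneg[of B] by (metis mult.left_commute mult_left_mono)
    also have "\<dots> \<le> norm (B v) * norm v"
      using rabier_nu_le[OF B, of \<phi>] \<phi> by (intro mult_left_mono) auto
    finally show ?thesis
      using False by (simp add: mult.assoc[symmetric])
  qed (simp add: linear_0[OF B])
qed

text \<open>Almost minimizing unit covectors subconverge to a unit vector \<open>\<psi>\<close>;
  passing to the limit in the adjoint identity makes the whole range of \<open>A\<close> orthogonal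
  to \<open>\<psi>\<close>.\<close>

lemma not_surj_if_rabier_nu_tendsto_0:
  fixes B :: "nat \<Rightarrow> 'a::euclidean_space \<Rightarrow>\<^sub>L 'b::euclidean_space"
  assumes B: "B \<longlonglongrightarrow> A" and nu: "(\<lambda>l. rabier_nu (blinfun_apply (B l))) \<longlonglongrightarrow> 0"
  shows "\<not> surj (blinfun_apply A)"
proof -
  \<comment> \<open>An error of \<open>1 / real (Suc l)\<close> replaces attainment of the infimum
    and disappears in the limit.\<close>
  have "\<exists>\<phi>\<in>sphere 0 1. norm (adjoint (blinfun_apply (B l)) \<phi>) < rabier_nu (blinfun_apply (B l)) + 1 / real (Suc l)" for l
  proof -
    have "(INF \<phi>\<in>sphere 0 1. norm (adjoint (blinfun_apply (B l)) \<phi>)) < rabier_nu (blinfun_apply (B l)) + 1 / real (Suc l)"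
      by (simp add: rabier_nu_def)
    then show ?thesis
      by (subst (asm) cINF_less_iff) (auto intro!: bdd_belowI2[where m = 0])
  qed
  then obtain \<phi> where \<phi>: "\<And>l. \<phi> l \<in> sphere 0 1"
    and less: "\<And>l. norm (adjoint (blinfun_apply (B l)) (\<phi> l)) < rabier_nu (blinfun_apply (B l)) + 1 / real (Suc l)"
    by metis
  obtain \<psi> r where \<psi>: "\<psi> \<in> sphere 0 1" and r: "strict_mono r" and lim: "(\<phi> \<circ> r) \<longlonglongrightarrow> \<psi>"
    using compact_sphere[of "0::'b" 1] \<phi> unfolding compact_def by metis
  have "(\<lambda>l. rabier_nu (blinfun_apply (B l)) + 1 / real (Suc l)) \<longlonglongrightarrow> 0 + 0"
    using nu lim_1_over_n[where 'a = real, THEN LIMSEQ_Suc] by (intro tendsto_add) auto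
  then have adj: "(\<lambda>l. adjoint (blinfun_apply (B l)) (\<phi> l)) \<longlonglongrightarrow> 0"
    unfolding add_0_right
    by (rule Lim_null_comparison[rotated]) (intro always_eventually allI less_imp_le less)
  have "A v \<bullet> \<psi> = 0" for v
  proof -
    have "(\<lambda>l. B (r l) v \<bullet> \<phi> (r l)) \<longlonglongrightarrow> A v \<bullet> \<psi>"
      using LIMSEQ_subseq_LIMSEQ[OF B r] lim
      by (intro tendsto_inner blinfun.tendsto tendsto_const) (auto simp: o_def)
    moreover have "(\<lambda>l. v \<bullet> adjoint (blinfun_apply (B (r l))) (\<phi> (r l))) \<longlonglongrightarrow> v \<bullet> 0"
      using LIMSEQ_subseq_LIMSEQ[OF adj r] by (intro tendsto_inner tendsto_const) (auto simp: o_def)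
    moreover have "v \<bullet> adjoint (blinfun_apply (B (r l))) (\<phi> (r l)) = B (r l) v \<bullet> \<phi> (r l)" for l
      by (simp add: adjoint_works bounded_linear.linear blinfun.bounded_linear_right)
    ultimately show ?thesis
      by (simp add: LIMSEQ_unique)
  qed
  moreover have "\<psi> \<noteq> 0"
    using \<psi> by auto
  ultimately show ?thesis
    by (metis inner_eq_zero_iff surjD)
qed

section \<open>Curves of at most exponential growth\<close>

lemma vector_derivative_lipschitz:
  fixes g :: "real \<Rightarrow> 'a::real_normed_vector"
  assumes "convex S"
    and "\<And>t. t \<in> S \<Longrightarrow> (g has_vector_derivative g' t) (at t within S)"
    and "\<And>t. t \<in> S \<Longrightarrow> norm (g' t) \<le> L"
    and "s \<in> S" "t \<in> S"
  shows "norm (g s - g t) \<le> L * \<bar>s - t\<bar>"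
proof -
  have "0 \<le> L"
    using assms(3)[OF \<open>s \<in> S\<close>] norm_ge_zero order_trans by blast
  then have "onorm (\<lambda>h. h *\<^sub>R g' t) \<le> L" if "t \<in> S" for t
    using assms(3)[OF that] by (intro onorm_bound) (simp_all add: mult.commute[of "\<bar>_\<bar>"] mult_right_mono)
  then show ?thesis
    using differentiable_bound[of S g "\<lambda>t h. h *\<^sub>R g' t" L s t] assms
    by (simp add: has_vector_derivative_def)
qed

text \<open>Gronwall's inequality, applied to \<open>ln (1 + \<parallel>g\<parallel>\<^sup>2)\<close> to avoid the zeros of the norm.\<close>

lemma tendsto_endpoint_if_linear_growth:
  fixes g :: "real \<Rightarrow> 'a::euclidean_space"
  assumes "a < b"
    and deriv: "\<And>t. t \<in> {a..<b} \<Longrightarrow> (g has_vector_derivative g' t) (at t within {a..<b})"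
    and growth: "\<And>t. t \<in> {a..<b} \<Longrightarrow> norm (g' t) \<le> C * (1 + norm (g t))"
  obtains x where "(g \<longlongrightarrow> x) (at b within {a..<b})"
proof -
  define u where "u t = ln (1 + g t \<bullet> g t)" for t
  have pos: "1 + g t \<bullet> g t > 0" for t
    by (smt (verit) inner_ge_zero)
  have C: "0 \<le> C"
    using growth[of a] \<open>a < b\<close> norm_ge_zero[of "g' a"] norm_ge_zero[of "g a"]
    by (smt (verit) atLeastLessThan_iff mult_neg_pos)
  have du: "(u has_vector_derivative (2 * (g t \<bullet> g' t) / (1 + g t \<bullet> g t))) (at t within {a..<b})"
    if "t \<in> {a..<b}" for t
  proof -
    have "((\<lambda>t. 1 + g t \<bullet> g t) has_real_derivative 2 * (g t \<bullet> g' t)) (at t within {a..<b})"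
      using deriv[OF that, unfolded has_vector_derivative_def]
      unfolding has_field_derivative_def
      by (auto intro!: derivative_eq_intros simp: inner_commute algebra_simps)
    then show ?thesis
      unfolding u_def has_real_derivative_iff_has_vector_derivative[symmetric]
      using DERIV_chain2[where g = "\<lambda>t. 1 + g t \<bullet> g t", OF DERIV_ln_divide[OF pos]] by simp
  qed
  have "norm (2 * (g t \<bullet> g' t) / (1 + g t \<bullet> g t)) \<le> 4 * C" if "t \<in> {a..<b}" for t
  proof -
    define n where "n = norm (g t)"
    \<comment> \<open>The square of \<open>n - 1/2\<close> is nonnegative, which gives
      \<open>n \<le> n * n + 1/4\<close>.\<close>
    have n: "0 \<le> n" "n \<le> 1 + n * n"
      using sum_squares_ge_zero[of "n - 1/2" 0] by (auto simp: n_def algebra_simps)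
    have "\<bar>g t \<bullet> g' t\<bar> \<le> n * norm (g' t)"
      unfolding n_def by (rule Cauchy_Schwarz_ineq2)
    also have "\<dots> \<le> n * (C * (1 + n))"
      using growth[OF that] by (simp add: n_def mult_left_mono)
    also have "\<dots> = C * (n + n * n)"
      by (simp add: algebra_simps)
    also have "\<dots> \<le> C * (2 * (1 + n * n))"
      using n C by (intro mult_left_mono) auto
    also have "n * n = g t \<bullet> g t"
      by (simp add: n_def dot_square_norm power2_eq_square)
    finally show ?thesis
      using pos[of t] by (simp add: abs_mult field_simps)
  qed
  then have u: "norm (u t - u a) \<le> 4 * C * \<bar>t - a\<bar>" if "t \<in> {a..<b}" for t
    using du that by (intro vector_derivative_lipschitz[where S = "{a..<b}"]) auto
  \<comment> \<open>Exponentiating the bound on \<open>u\<close> over the whole interval bounds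
    \<open>g\<close> independently of \<open>t\<close>.\<close>
  define M where "M = sqrt (exp (u a + 4 * C * (b - a)))"
  have M: "norm (g t) \<le> M" if t: "t \<in> {a..<b}" for t
  proof -
    have "C * (t - a) \<le> C * (b - a)"
      using t C by (intro mult_left_mono) auto
    then have "u t \<le> u a + 4 * C * (b - a)"
      using u[OF t] t by simp
    then have "exp (u t) \<le> exp (u a + 4 * C * (b - a))"
      by simp
    then show ?thesis
      using pos[of t] unfolding M_def norm_eq_sqrt_inner by (intro real_sqrt_le_mono) (auto simp: u_def)
  qed
  have "norm (g' t) \<le> C * (1 + M)" if "t \<in> {a..<b}" for t
    using growth[OF that] M[OF that] C by (smt (verit) mult_left_mono)
  then have lip: "norm (g s - g t) \<le> C * (1 + M) * \<bar>s - t\<bar>" if "s \<in> {a..<b}" "t \<in> {a..<b}" for s t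
    using deriv that by (intro vector_derivative_lipschitz[where S = "{a..<b}"]) auto
  have "0 \<le> M"
    by (simp add: M_def)
  \<comment> \<open>A bounded curve of linear growth has bounded speed; being uniformly continuous,
    it extends to the endpoint \<open>b\<close>.\<close>
  then have "(C * (1 + M))-lipschitz_on {a..<b} g"
    using lip C by (auto simp: lipschitz_on_def dist_norm)
  then have "uniformly_continuous_on {a..<b} g"
    by (rule lipschitz_on_uniformly_continuous)
  moreover have "b \<in> closure {a..<b}"
    using \<open>a < b\<close> by simp
  ultimately show ?thesis
    using that uniformly_continuous_on_extension_at_closure by blast
qed

section \<open>Local diffeomorphisms with finite lifting rate\<close>

text \<open>The resolvent identity \<open>B t - B0 = B t o (A0 - A t) o B0\<close> gives the limit
  once \<open>B t\<close> is bounded. Boundedness comes from the same identity: when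
  \<open>?\<delta> t * ?M < 1 / 2\<close>, half of \<open>norm (B t)\<close> is absorbed on the
  left. This provides continuity of the derivative of the inverse map.\<close>

lemma tendsto_blinfun_inverse:
  fixes A B :: "'t \<Rightarrow> 'a::real_normed_vector \<Rightarrow>\<^sub>L 'a"
  assumes A: "(A \<longlongrightarrow> A0) F"
    and BA: "\<And>t. B t o\<^sub>L A t = id_blinfun" and AB: "A0 o\<^sub>L B0 = id_blinfun"
  shows "(B \<longlongrightarrow> B0) F"
proof -
  let ?\<delta> = "\<lambda>t. norm (A0 - A t)" and ?M = "norm B0"
  have \<delta>: "(?\<delta> \<longlongrightarrow> 0) F"
    using tendsto_diff[OF tendsto_const A, of A0] by (intro tendsto_norm_zero) simp
  have "B t - B0 = B t o\<^sub>L ((A0 - A t) o\<^sub>L B0)" for t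
  proof (rule blinfun_eqI)
    fix v
    have "A0 (B0 v) = v" "B t (A t (B0 v)) = B0 v"
      using BA[of t] AB by (metis blinfun_apply_blinfun_compose blinfun_apply_id_blinfun)+
    then show "(B t - B0) v = (B t o\<^sub>L ((A0 - A t) o\<^sub>L B0)) v"
      by (simp add: blinfun.bilinear_simps)
  qed
  then have le: "norm (B t - B0) \<le> norm (B t) * (?\<delta> t * ?M)" for t
    using norm_blinfun_compose[of "B t" "(A0 - A t) o\<^sub>L B0"]
      mult_left_mono[OF norm_blinfun_compose[of "A0 - A t" B0], of "norm (B t)"] by simp
  have lim: "((\<lambda>t. ?\<delta> t * ?M) \<longlongrightarrow> 0) F"
    using \<delta> by (rule tendsto_mult_left_zero)
  then have small: "\<forall>\<^sub>F t in F. ?\<delta> t * ?M < 1 / 2"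
    by (rule order_tendstoD) simp
  have "\<forall>\<^sub>F t in F. norm (B t - B0) \<le> 2 * ?M * (?\<delta> t * ?M)"
    using small
  proof eventually_elim
    case (elim t)
    have "norm (B t) * (?\<delta> t * ?M) \<le> norm (B t) * (1 / 2)"
      using elim by (intro mult_left_mono) auto
    then have "norm (B t) \<le> 2 * ?M"
      using le[of t] norm_triangle_ineq2[of "B t" B0] by simp
    then have "norm (B t) * (?\<delta> t * ?M) \<le> 2 * ?M * (?\<delta> t * ?M)"
      by (intro mult_right_mono) auto
    then show ?case
      using le[of t] by simp
  qed
  moreover have "((\<lambda>t. 2 * ?M * (?\<delta> t * ?M)) \<longlongrightarrow> 0) F"
    using lim by (rule tendsto_mult_right_zero)
  ultimately have "((\<lambda>t. B t - B0) \<longlongrightarrow> 0) F"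
    by (rule Lim_null_comparison)
  then show ?thesis
    by (rule Lim_null[THEN iffD2])
qed

lemma convergent_subseq_if_not_norm_at_top:
  fixes x :: "nat \<Rightarrow> 'a::euclidean_space"
  assumes "\<not> filterlim (\<lambda>l. norm (x l)) at_top sequentially"
  obtains r a where "strict_mono r" "(x \<circ> r) \<longlonglongrightarrow> a"
proof -
  obtain B where "\<not> (\<forall>\<^sub>F l in sequentially. B \<le> norm (x l))"
    using assms unfolding filterlim_at_top by blast
  then have "infinite {l. \<not> B \<le> norm (x l)}"
    unfolding cofinite_eq_sequentially[symmetric] eventually_cofinite .
  then obtain s :: "nat \<Rightarrow> nat" where s: "strict_mono s" "\<And>l. \<not> B \<le> norm (x (s l))"
    using infinite_enumerate by (metis mem_Collect_eq)
  then have "\<forall>l. (x \<circ> s) l \<in> cball 0 B"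
    by (simp add: less_imp_le not_le)
  then obtain a r where "strict_mono r" "((x \<circ> s) \<circ> r) \<longlonglongrightarrow> a"
    using compact_cball[of "0::'a" B] unfolding compact_def by blast
  then show ?thesis
    using that[of "s \<circ> r"] s(1) by (simp add: comp_assoc strict_mono_o)
qed

locale local_diffeo =
  fixes F :: "'a::euclidean_space \<Rightarrow> 'a" and F' :: "'a \<Rightarrow> 'a \<Rightarrow>\<^sub>L 'a"
  assumes deriv: "(F has_derivative F' x) (at x)"
    and cont_deriv: "continuous_on UNIV F'"
    and surj_deriv: "surj (F' x)"
begin

section \<open>Local inverses and uniqueness of lifts\<close>

lemma linear_deriv: "linear (F' x)"
  by (simp add: blinfun.bounded_linear_right bounded_linear.linear)

lemma bij_deriv: "bij (F' x)"
  using linear_surjective_imp_injective[OF linear_deriv surj_deriv] surj_deriv by (simp add: bij_def)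

lemma linear_inv_deriv: "linear (inv (F' x))"
  using linear_deriv bij_is_inj[OF bij_deriv] by (rule inj_linear_imp_inv_linear)

lemma continuous_on_F: "continuous_on S F"
  by (rule has_derivative_continuous_on) (rule has_derivative_at_withinI[OF deriv])

lemma tendsto_F: "(f \<longlongrightarrow> x) G \<Longrightarrow> ((\<lambda>t. F (f t)) \<longlongrightarrow> F x) G"
  using has_derivative_continuous[OF deriv] by (rule isCont_tendsto_compose)

text \<open>Only the topological half of the inverse function theorem is kept; differentiability of
  inverses is recovered in \<open>section_has_derivative\<close>.\<close>

lemma local_inverse:
  obtains U V h where "open U" "x \<in> U" "open V" "F x \<in> V" "homeomorphism U V F h"
proof -
  have "bounded_linear (inv (F' x))"
    using linear_inv_deriv by (simp add: linear_conv_bounded_linear)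
  then have "Blinfun (inv (F' x)) o\<^sub>L F' x = id_blinfun"
    using bij_deriv by (auto simp: bounded_linear_Blinfun_apply bij_is_inj intro!: blinfun_eqI)
  then show ?thesis
    using inverse_function_theorem[OF open_UNIV deriv cont_deriv UNIV_I] that by metis
qed

text \<open>The set where two lifts agree is closed in \<open>S\<close> by continuity, and open
  because \<open>F\<close> is injective near a common value; connectedness does the rest.\<close>

lemma lift_unique:
  fixes f g :: "'b::topological_space \<Rightarrow> 'a"
  assumes "connected S" "continuous_on S f" "continuous_on S g"
    and eq: "\<And>y. y \<in> S \<Longrightarrow> F (f y) = F (g y)"
    and "a \<in> S" "f a = g a" "y \<in> S"
  shows "f y = g y"
proof -
  let ?E = "{y \<in> S. f y = g y}"
  have "closedin (top_of_set S) ?E"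
  proof -
    have "closedin (top_of_set S) (S \<inter> (\<lambda>y. f y - g y) -` {0})"
      using assms(2,3) by (intro continuous_closedin_preimage continuous_on_diff) auto
    moreover have "S \<inter> (\<lambda>y. f y - g y) -` {0} = ?E" by auto
    ultimately show ?thesis by simp
  qed
  moreover have "openin (top_of_set S) ?E"
  proof (subst openin_subopen, intro ballI)
    fix z assume z: "z \<in> ?E"
    obtain U V h where U: "open U" "f z \<in> U" "homeomorphism U V F h"
      using local_inverse by metis
    let ?T = "(S \<inter> f -` U) \<inter> (S \<inter> g -` U)"
    have "openin (top_of_set S) ?T"
      using assms(2,3) U(1) by (intro openin_Int continuous_openin_preimage_gen)
    moreover have "?T \<subseteq> ?E"
      using U(3) eq unfolding homeomorphism_def by (auto; metis)
    moreover have "z \<in> ?T"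
      using z U(2) by auto
    ultimately show "\<exists>T. openin (top_of_set S) T \<and> z \<in> T \<and> T \<subseteq> ?E" by blast
  qed
  ultimately have "?E = {} \<or> ?E = S"
    using \<open>connected S\<close> unfolding connected_clopen by blast
  then show ?thesis
    using assms(5-7) by blast
qed

section \<open>Continuous right inverses of \<open>F\<close> over subsets of the target\<close>

definition section_on :: "'a set \<Rightarrow> ('a \<Rightarrow> 'a) \<Rightarrow> bool" where
  "section_on V G \<longleftrightarrow> continuous_on V G \<and> (\<forall>y\<in>V. F (G y) = y)"

lemma section_on_subset: "section_on V G \<Longrightarrow> W \<subseteq> V \<Longrightarrow> section_on W G"
  unfolding section_on_def by (meson continuous_on_subset subsetD)

lemma section_on_cong: "section_on V G \<Longrightarrow> (\<And>y. y \<in> V \<Longrightarrow> H y = G y) \<Longrightarrow> section_on V H"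
  unfolding section_on_def by (metis continuous_on_eq)

lemma section_unique:
  assumes "connected V" "section_on V G" "section_on V H" "a \<in> V" "G a = H a" "y \<in> V"
  shows "G y = H y"
  using lift_unique[of V G H a y] assms unfolding section_on_def by metis

lemma section_on_Un:
  assumes "section_on V G" "section_on W H" "open V" "open W"
    and "\<And>y. y \<in> V \<inter> W \<Longrightarrow> G y = H y"
  shows "section_on (V \<union> W) (\<lambda>y. if y \<in> V then G y else H y)"
proof -
  let ?K = "\<lambda>y. if y \<in> V then G y else H y"
  have "section_on V ?K"
    using assms(1) by (rule section_on_cong) simp
  moreover have "section_on W ?K"
    using assms(2) by (rule section_on_cong) (simp add: assms(5))
  ultimately show ?thesis
    using assms(3,4) by (auto simp: section_on_def intro: continuous_on_open_Un)
qed

text \<open>Continuity of a right inverse already forces differentiability where the derivative of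
  \<open>F\<close> is invertible.\<close>

lemma section_has_derivative:
  assumes "section_on V G" "open V" "y \<in> V"
  shows "(G has_derivative inv (F' (G y))) (at y)"
proof (rule has_derivative_inverse_basic[OF deriv])
  show "bounded_linear (inv (F' (G y)))"
    using linear_inv_deriv by (simp add: linear_conv_bounded_linear)
  show "inv (F' (G y)) \<circ> F' (G y) = id"
    using bij_deriv by (simp add: bij_is_inj)
  show "continuous (at y) G"
    using assms by (simp add: section_on_def continuous_on_eq_continuous_at)
qed (use assms in \<open>auto simp: section_on_def\<close>)

text \<open>Points violating every bound form a sequence whose values tend to \<open>b\<close>. If
  it went to infinity, \<open>b\<close> would lie in \<open>K_infinity F\<close>; otherwise a
  subsequence converges to a point where the derivative would fail to be surjective.\<close>

lemma rabier_lower_bound: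
  assumes "K_infinity F = {}"
  obtains \<eta> \<epsilon> where "\<eta> > 0" "\<epsilon> > 0"
    "\<And>x. dist (F x) b < \<eta> \<Longrightarrow> \<epsilon> \<le> (1 + norm x) * rabier_nu (F' x)"
proof (rule ccontr)
  assume "\<not> thesis"
  then have "\<exists>x. dist (F x) b < 1 / real (Suc l) \<and> (1 + norm x) * rabier_nu (F' x) < 1 / real (Suc l)" for l
    using that by (metis not_le of_nat_0_less_iff zero_less_Suc zero_less_divide_1_iff)
  then obtain x where x: "\<And>l. dist (F (x l)) b < 1 / real (Suc l)"
    and nu: "\<And>l. (1 + norm (x l)) * rabier_nu (F' (x l)) < 1 / real (Suc l)"
    by metis
  have lim0: "(\<lambda>l. 1 / real (Suc l)) \<longlonglongrightarrow> 0"
    using lim_1_over_n[where 'a = real, THEN LIMSEQ_Suc] by simp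
  have "(\<lambda>l. dist (F (x l)) b) \<longlonglongrightarrow> 0"
    by (rule Lim_null_comparison[OF _ lim0]) (intro always_eventually allI, simp add: x less_imp_le del: of_nat_Suc)
  then have Fx: "(\<lambda>l. F (x l)) \<longlonglongrightarrow> b"
    by (rule tendsto_dist_iff[THEN iffD2])
  have nu0: "(\<lambda>l. (1 + norm (x l)) * rabier_nu (F' (x l))) \<longlonglongrightarrow> 0"
    by (rule Lim_null_comparison[OF _ lim0])
      (intro always_eventually allI, simp add: nu rabier_nu_nonneg less_imp_le del: of_nat_Suc)
  have "\<not> filterlim (\<lambda>l. norm (x l)) at_top sequentially"
    using assms Fx nu0 unfolding K_infinity_def frechet_derivative_at[OF deriv, symmetric] by blast
  then obtain a r where r: "strict_mono r" and a: "(x \<circ> r) \<longlonglongrightarrow> a"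
    by (rule convergent_subseq_if_not_norm_at_top)
  have "isCont F' a"
    using cont_deriv by (simp add: continuous_on_eq_continuous_at)
  then have "(\<lambda>l. F' ((x \<circ> r) l)) \<longlonglongrightarrow> F' a"
    using a by (rule isCont_tendsto_compose)
  moreover have "(\<lambda>l. rabier_nu (F' ((x \<circ> r) l))) \<longlonglongrightarrow> 0"
  proof (rule Lim_null_comparison[OF _ LIMSEQ_subseq_LIMSEQ[OF nu0 r]])
    \<comment> \<open>The weight is at least 1, so the Rabier numbers themselves tend to 0.\<close>
    have "rabier_nu (F' y) \<le> (1 + norm y) * rabier_nu (F' y)" for y
      using mult_right_mono[of 1 "1 + norm y" "rabier_nu (F' y)"] rabier_nu_nonneg[of "F' y"] by simp
    then show "\<forall>\<^sub>F l in sequentially. norm (rabier_nu (F' ((x \<circ> r) l)))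
        \<le> ((\<lambda>l. (1 + norm (x l)) * rabier_nu (F' (x l))) \<circ> r) l"
      by (intro always_eventually allI) (simp add: rabier_nu_nonneg)
  qed
  ultimately show False
    using not_surj_if_rabier_nu_tendsto_0 surj_deriv by blast
qed

text \<open>The lift of the segment has velocity \<open>v t\<close>, which \<open>F'\<close> maps to
  \<open>b - a\<close>. The lower bound on the Rabier number near \<open>b\<close> therefore limits
  its speed to a constant times \<open>1 + norm\<close> of the position, and
  \<open>tendsto_endpoint_if_linear_growth\<close> applies.\<close>

lemma lift_tendsto_endpoint:
  assumes K: "K_infinity F = {}"
    and "section_on U G" "open U"
    and c: "\<And>t. t \<in> {0..<1} \<Longrightarrow> a + t *\<^sub>R (b - a) \<in> U"
  obtains x s where "s \<in> {0..<1}" "((\<lambda>t. G (a + t *\<^sub>R (b - a))) \<longlongrightarrow> x) (at 1 within {s..<1})" "F x = b"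
proof -
  define \<gamma> where "\<gamma> t = a + t *\<^sub>R (b - a)" for t
  define v where "v t = inv (F' (G (\<gamma> t))) (b - a)" for t
  obtain \<eta> \<epsilon> where \<eta>: "\<eta> > 0" and \<epsilon>: "\<epsilon> > 0"
    and bound: "\<And>x. dist (F x) b < \<eta> \<Longrightarrow> \<epsilon> \<le> (1 + norm x) * rabier_nu (F' x)"
    using rabier_lower_bound[OF K] by metis
  have "(\<gamma> \<longlongrightarrow> a + 1 *\<^sub>R (b - a)) (at_left 1)"
    unfolding \<gamma>_def by (intro tendsto_intros)
  then have "(\<gamma> \<longlongrightarrow> b) (at_left 1)" by simp
  then have "\<forall>\<^sub>F t in at_left 1. dist (\<gamma> t) b < \<eta>"
    using \<eta> by (simp add: tendsto_iff)
  then obtain s0 where s0: "s0 < 1" "\<And>t. s0 < t \<Longrightarrow> t < 1 \<Longrightarrow> dist (\<gamma> t) b < \<eta>"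
    unfolding eventually_at_left_field by blast
  \<comment> \<open>The lower bound holds only near \<open>b\<close>, so the lift is studied from
    \<open>s\<close> on; the midpoint of \<open>s0\<close> and 1 is strictly beyond
    \<open>s0\<close>, and the maximum keeps \<open>s\<close> in the unit interval.\<close>
  define s where "s = max 0 ((s0 + 1) / 2)"
  have s: "s \<in> {0..<1}" "s0 < s"
    using s0(1) by (auto simp: s_def max_def field_simps)
  have U: "\<gamma> t \<in> U" if "t \<in> {s..<1}" for t
    using c[of t] that s by (simp add: \<gamma>_def)
  have FG: "F (G (\<gamma> t)) = \<gamma> t" if "t \<in> {s..<1}" for t
    using U[OF that] assms(2) by (simp add: section_on_def)
  have "((G \<circ> \<gamma>) has_vector_derivative v t) (at t within {s..<1})" if "t \<in> {s..<1}" for t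
  proof -
    have "(\<gamma> has_derivative (\<lambda>h. h *\<^sub>R (b - a))) (at t within {s..<1})"
      unfolding \<gamma>_def by (auto intro!: derivative_eq_intros)
    then have "(G \<circ> \<gamma> has_derivative inv (F' (G (\<gamma> t))) \<circ> (\<lambda>h. h *\<^sub>R (b - a))) (at t within {s..<1})"
      using section_has_derivative[OF assms(2,3) U[OF that]]
      by (intro diff_chain_within) (auto intro: has_derivative_at_withinI)
    then show ?thesis
      by (simp add: has_vector_derivative_def v_def o_def linear_cmul[OF linear_inv_deriv])
  qed
  moreover have "norm (v t) \<le> norm (b - a) / \<epsilon> * (1 + norm ((G \<circ> \<gamma>) t))" if t: "t \<in> {s..<1}" for t
  proof -
    let ?x = "G (\<gamma> t)"
    have "F' ?x (v t) = b - a"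
      using surj_deriv by (simp add: v_def surj_f_inv_f)
    then have "rabier_nu (F' ?x) * norm (v t) \<le> norm (b - a)"
      using rabier_nu_mult_norm_le[OF linear_deriv surj_deriv, of ?x "v t"] by simp
    then have "(1 + norm ?x) * (rabier_nu (F' ?x) * norm (v t)) \<le> (1 + norm ?x) * norm (b - a)"
      by (intro mult_left_mono) auto
    moreover have "\<epsilon> * norm (v t) \<le> (1 + norm ?x) * rabier_nu (F' ?x) * norm (v t)"
      using bound[of ?x] s0(2)[of t] t s FG[OF t] by (intro mult_right_mono) auto
    ultimately show ?thesis
      using \<epsilon> by (simp add: field_simps)
  qed
  moreover have "s < 1"
    using s by simp
  ultimately obtain x where x: "((G \<circ> \<gamma>) \<longlongrightarrow> x) (at 1 within {s..<1})"
    using tendsto_endpoint_if_linear_growth by metis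
  have "(\<gamma> \<longlongrightarrow> b) (at 1 within {s..<1})"
    using \<open>(\<gamma> \<longlongrightarrow> b) (at_left 1)\<close> by (rule tendsto_within_subset) auto
  moreover have "((\<lambda>t. F ((G \<circ> \<gamma>) t)) \<longlongrightarrow> F x) (at 1 within {s..<1})"
    using x by (rule tendsto_F)
  then have "(\<gamma> \<longlongrightarrow> F x) (at 1 within {s..<1})"
    by (rule Lim_transform_within[OF _ zero_less_one]) (simp add: FG)
  moreover have "at 1 within {s..<1} \<noteq> bot"
    using s by (simp add: trivial_limit_within islimpt_Ico)
  ultimately have "F x = b"
    using tendsto_unique by blast
  then show ?thesis
    using that s(1) x by (simp add: o_def \<gamma>_def)
qed

section \<open>Gluing sections over convex neighbourhoods into a global one\<close>

definition liftable :: "'a \<Rightarrow> 'a set \<Rightarrow> ('a \<Rightarrow> 'a) \<Rightarrow> bool" where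
  "liftable x V G \<longleftrightarrow> open V \<and> convex V \<and> F x \<in> V \<and> section_on V G \<and> G (F x) = x"

text \<open>Convexity is required in \<open>liftable\<close> for this: two convex sets containing
  \<open>F x\<close> have a connected intersection that contains \<open>F x\<close>, where both
  sections take the value \<open>x\<close>.\<close>

lemma liftable_unique:
  assumes "liftable x V G" "liftable x W H" "y \<in> V" "y \<in> W"
  shows "G y = H y"
proof -
  have "connected (V \<inter> W)" "F x \<in> V \<inter> W"
    using assms by (auto simp: liftable_def convex_Int convex_connected)
  moreover have "section_on (V \<inter> W) G" "section_on (V \<inter> W) H"
    using assms section_on_subset by (auto simp: liftable_def)
  ultimately show ?thesis
    using section_unique[of "V \<inter> W" G H "F x" y] assms by (simp add: liftable_def)
qed

lemma liftable_ex: "\<exists>V G. liftable x V G"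
proof -
  obtain U V h where U: "x \<in> U" "open V" "F x \<in> V" "homeomorphism U V F h"
    using local_inverse by metis
  obtain e where "e > 0" "ball (F x) e \<subseteq> V"
    using U openE by metis
  then have "liftable x (ball (F x) e) h"
    using U by (auto simp: liftable_def section_on_def homeomorphism_def intro: continuous_on_subset)
  then show ?thesis by blast
qed

text \<open>All liftable sections based at \<open>x0\<close> glue to a section \<open>G\<close> over
  the union \<open>U\<close> of their domains. If \<open>U\<close> missed a point, a segment from
  \<open>y0\<close> would have a first point \<open>b\<close> outside \<open>U\<close>. The lift
  converges at \<open>b\<close>, so a local inverse there continues it, and a convex tube around the
  segment becomes a liftable domain containing \<open>b\<close>.\<close>

lemma section_ex:
  assumes K: "K_infinity F = {}"
  obtains G where "section_on UNIV G" "G (F x0) = x0"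
proof -
  define y0 where "y0 = F x0"
  define U where "U = {y. \<exists>V G. y \<in> V \<and> liftable x0 V G}"
  have "\<forall>y\<in>U. \<exists>p. y \<in> fst p \<and> liftable x0 (fst p) (snd p)"
    by (auto simp: U_def)
  then obtain p where "\<forall>y\<in>U. y \<in> fst (p y) \<and> liftable x0 (fst (p y)) (snd (p y))"
    by (rule bchoice[THEN exE])
  then obtain V K where VK: "\<And>y. y \<in> U \<Longrightarrow> y \<in> V y \<and> liftable x0 (V y) (K y)"
    using that[of "\<lambda>y. fst (p y)" "\<lambda>y. snd (p y)"] by blast
  \<comment> \<open>The section chosen for \<open>y\<close> is evaluated at \<open>y\<close>; by
    \<open>liftable_unique\<close> the choice does not affect the value.\<close>
  define G where "G y = K y y" for y
  have sub: "W \<subseteq> U" if "liftable x0 W H" for W H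
    using that by (auto simp: U_def)
  have G_eq: "G y = H y" if "liftable x0 W H" "y \<in> W" for W H y
    unfolding G_def using that VK sub liftable_unique by blast
  have G_section: "section_on W G" if "liftable x0 W H" for W H
    using that section_on_cong[of W H G] G_eq by (auto simp: liftable_def)
  have "open U"
    using VK sub by (subst open_subopen) (meson liftable_def)
  have "continuous (at y) G \<and> F (G y) = y" if "y \<in> U" for y
  proof -
    have "open (V y)" "y \<in> V y" "section_on (V y) G"
      using VK[OF that] G_section by (auto simp: liftable_def)
    then show ?thesis
      by (simp add: section_on_def continuous_on_eq_continuous_at)
  qed
  then have "section_on U G"
    by (simp add: section_on_def continuous_at_imp_continuous_on)
  have "y0 \<in> U" "G y0 = x0"
    using liftable_ex[of x0] G_eq by (auto simp: U_def y0_def liftable_def)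
  have "U = UNIV"
  proof (rule ccontr)
    assume "U \<noteq> UNIV"
    then obtain y where "y \<notin> U" by auto
    \<comment> \<open>\<open>T\<close> collects the parameters at which the segment is outside
      \<open>U\<close>; its least element marks the first exit.\<close>
    define T where "T = {0..1} \<inter> (\<lambda>s. y0 + s *\<^sub>R (y - y0)) -` (- U)"
    have "closed T"
      unfolding T_def using \<open>open U\<close> by (intro continuous_closed_preimage continuous_intros) auto
    then have "compact T"
      using compact_Icc by (metis T_def closed_Int_compact inf_le1 inf.absorb_iff2 inf_commute)
    moreover have "1 \<in> T"
      using \<open>y \<notin> U\<close> by (simp add: T_def)
    ultimately obtain \<sigma> where \<sigma>: "\<sigma> \<in> T" and min: "\<And>s. s \<in> T \<Longrightarrow> \<sigma> \<le> s"
      using compact_attains_inf[of T] by blast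
    define b where "b = y0 + \<sigma> *\<^sub>R (y - y0)"
    define \<gamma> where "\<gamma> t = y0 + t *\<^sub>R (b - y0)" for t
    have "b \<notin> U" "0 \<le> \<sigma>" "\<sigma> \<le> 1"
      using \<sigma> by (auto simp: T_def b_def)
    have "\<sigma> > 0"
      using \<open>b \<notin> U\<close> \<open>y0 \<in> U\<close> \<open>0 \<le> \<sigma>\<close> by (cases "\<sigma> = 0") (auto simp: b_def)
    have \<gamma>: "\<gamma> t \<in> U" if "t \<in> {0..<1}" for t
    proof (rule ccontr)
      assume "\<gamma> t \<notin> U"
      \<comment> \<open>The segment to \<open>b\<close> is the original one slowed down by
        \<open>\<sigma>\<close>, so an earlier exit would contradict minimality.\<close>
      then have "t * \<sigma> \<in> T"
        using that \<open>0 \<le> \<sigma>\<close> \<open>\<sigma> \<le> 1\<close> by (auto simp: T_def \<gamma>_def b_def mult_le_one)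
      then show False
        using min[of "t * \<sigma>"] that \<open>\<sigma> > 0\<close> by simp
    qed
    obtain x s where s: "s \<in> {0..<1}" and x: "((\<lambda>t. G (\<gamma> t)) \<longlongrightarrow> x) (at 1 within {s..<1})" and "F x = b"
      using lift_tendsto_endpoint[OF K \<open>section_on U G\<close> \<open>open U\<close>, of y0 b] \<gamma> unfolding \<gamma>_def by metis
    obtain A B h where A: "open A" "x \<in> A" "open B" "b \<in> B" and h: "homeomorphism A B F h"
      using local_inverse[of x] \<open>F x = b\<close> by metis
    obtain e where e: "e > 0" "ball b e \<subseteq> B"
      using A openE by metis
    have h_section: "section_on (ball b e) h"
      using h e by (auto simp: section_on_def homeomorphism_def intro: continuous_on_subset)
    have "(\<gamma> \<longlongrightarrow> y0 + 1 *\<^sub>R (b - y0)) (at 1 within {s..<1})"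
      unfolding \<gamma>_def by (intro tendsto_intros)
    then have "\<forall>\<^sub>F t in at 1 within {s..<1}. \<gamma> t \<in> ball b e"
      using e by (auto simp: tendsto_iff dist_commute)
    moreover have "\<forall>\<^sub>F t in at 1 within {s..<1}. G (\<gamma> t) \<in> A"
      using x A by (simp add: topological_tendstoD)
    moreover have "\<forall>\<^sub>F t in at 1 within {s..<1}. t \<in> {s..<1}"
      by (simp add: eventually_at_filter)
    \<comment> \<open>So close to the end, \<open>\<gamma> t\<close> is in the domain of the local
      section \<open>h\<close>, and \<open>G (\<gamma> t)\<close> is in the set \<open>A\<close>
      where \<open>h\<close> inverts \<open>F\<close>; hence both sections agree at this
      point.\<close>
    ultimately have "\<forall>\<^sub>F t in at 1 within {s..<1}. \<gamma> t \<in> ball b e \<and> G (\<gamma> t) \<in> A \<and> t \<in> {s..<1}"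
      by (intro eventually_conj)
    moreover have "at 1 within {s..<1} \<noteq> bot"
      using s by (simp add: trivial_limit_within islimpt_Ico)
    ultimately obtain t where t: "\<gamma> t \<in> ball b e" "G (\<gamma> t) \<in> A" "t \<in> {s..<1}"
      using eventually_happens' by blast
    define p where "p = \<gamma> t"
    have "p \<in> U"
      using \<gamma>[of t] t s by (simp add: p_def)
    then obtain W H where WH: "p \<in> W" "liftable x0 W H"
      by (auto simp: U_def)
    then have W: "open W" "convex W" "y0 \<in> W" "section_on W H" "H y0 = x0"
      by (auto simp: liftable_def y0_def)
    have "H p = h p"
    proof -
      have "h (F (G p)) = G p"
        using h t by (simp add: homeomorphism_def p_def)
      moreover have "F (G p) = p"
        using \<open>section_on U G\<close> \<open>p \<in> U\<close> by (simp add: section_on_def)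
      ultimately show ?thesis
        using G_eq[OF WH(2,1)] by simp
    qed
    \<comment> \<open>Agreement at the single point \<open>p\<close> spreads over the overlap, which
      is convex and hence connected.\<close>
    have agree: "H z = h z" if "z \<in> W \<inter> ball b e" for z
    proof (rule section_unique[where V = "W \<inter> ball b e" and G = H and H = h and a = p])
      show "connected (W \<inter> ball b e)"
        using W by (simp add: convex_Int convex_connected)
      show "section_on (W \<inter> ball b e) H" "section_on (W \<inter> ball b e) h"
        using W h_section by (auto elim: section_on_subset)
      show "p \<in> W \<inter> ball b e"
        using WH t by (simp add: p_def)
    qed (use \<open>H p = h p\<close> that in auto)
    define L where "L z = (if z \<in> W then H z else h z)" for z
    have L: "section_on (W \<union> ball b e) L"
      unfolding L_def using W h_section agree by (intro section_on_Un) auto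
    have "p = (1 - t) *\<^sub>R y0 + t *\<^sub>R b"
      by (simp add: p_def \<gamma>_def algebra_simps)
    then have "p \<in> closed_segment y0 b"
      using s t by (auto simp: in_segment intro!: exI[of _ t])
    then have "closed_segment y0 b \<subseteq> closed_segment y0 p \<union> closed_segment p b"
      using Un_closed_segment by blast
    moreover have "closed_segment y0 p \<subseteq> W"
      using W WH by (simp add: closed_segment_subset)
    moreover have "closed_segment p b \<subseteq> ball b e"
      using t e by (intro closed_segment_subset) (auto simp: p_def)
    ultimately have "closed_segment y0 b \<subseteq> W \<union> ball b e"
      by blast
    moreover have "open (W \<union> ball b e)"
      using W by auto
    ultimately obtain d where "d > 0" and d: "(\<Union>z\<in>closed_segment y0 b. ball z d) \<subseteq> W \<union> ball b e"
      using compact_subset_open_imp_ball_epsilon_subset[OF compact_segment] by blast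
    let ?D = "\<Union>z\<in>closed_segment y0 b. ball z d"
    \<comment> \<open>The tube is the Minkowski sum of a segment and a ball, hence convex. The union
      \<open>W \<union> ball b e\<close> itself need not be.\<close>
    have "?D = (\<Union>z\<in>closed_segment y0 b. \<Union>w\<in>ball 0 d. {z + w})"
      by (simp add: ball_translation[symmetric] UNION_singleton_eq_range)
    then have "convex ?D"
      using convex_sums[of "closed_segment y0 b" "ball 0 d"] by simp
    moreover have "y0 \<in> ?D" "b \<in> ?D"
      using \<open>d > 0\<close> by force+
    moreover have "open ?D" by auto
    moreover have "section_on ?D L"
      using L d by (rule section_on_subset)
    moreover have "L y0 = x0"
      using W by (simp add: L_def)
    ultimately have "liftable x0 ?D L"
      by (simp add: liftable_def y0_def)
    then show False
      using sub \<open>b \<in> ?D\<close> \<open>b \<notin> U\<close> by blast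
  qed
  then show ?thesis
    using that \<open>section_on U G\<close> \<open>G y0 = x0\<close> by (simp add: y0_def)
qed

text \<open>Both \<open>G \<circ> F\<close> and the identity lift \<open>F\<close> through itself
  and agree at 0, so the global section is a two-sided inverse. Its derivative inverts that of
  \<open>F\<close>, and inversion of operators is continuous.\<close>

theorem global_diffeomorphism_if_K_infinity_empty:
  assumes "K_infinity F = {}"
  shows "global_diffeomorphism F"
proof -
  obtain G where G: "section_on UNIV G" "G (F 0) = 0"
    using section_ex[OF assms] by metis
  then have FG: "F (G y) = y" for y
    by (simp add: section_on_def)
  have "continuous_on UNIV (\<lambda>x. G (F x))"
    using G(1) continuous_on_F by (auto simp: section_on_def intro!: continuous_on_compose2[of UNIV G])
  then have GF: "G (F x) = x" for x
    using lift_unique[of UNIV "\<lambda>x. G (F x)" "\<lambda>x. x" 0 x] FG G(2) by auto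
  have "bij F"
    using FG GF by (metis bijI')
  have inv: "inv F = G"
    using FG GF by (metis inv_equality ext)
  have dG: "(G has_derivative inv (F' (G y))) (at y)" for y
    using section_has_derivative[OF G(1)] by simp
  have bl: "bounded_linear (inv (F' x))" for x
    using linear_inv_deriv by (simp add: linear_conv_bounded_linear)
  define G' where "G' y = Blinfun (inv (F' (G y)))" for y
  have app: "blinfun_apply (G' y) = inv (F' (G y))" for y
    by (simp add: G'_def bounded_linear_Blinfun_apply[OF bl])
  have "isCont G' y" for y
    unfolding isCont_def
  proof (rule tendsto_blinfun_inverse)
    have "isCont F' (G y)" "isCont G y"
      using cont_deriv G(1) by (auto simp: section_on_def continuous_on_eq_continuous_at)
    then show "(\<lambda>z. F' (G z)) \<midarrow>y\<rightarrow> F' (G y)"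
      by (simp add: isCont_def isCont_tendsto_compose)
  qed (auto simp: app bij_deriv bij_is_inj bij_is_surj surj_f_inv_f intro!: blinfun_eqI)
  then have "continuous_on UNIV G'"
    by (simp add: continuous_at_imp_continuous_on)
  then have "C1_map G"
    unfolding C1_map_def using dG app by metis
  moreover have "C1_map F"
    unfolding C1_map_def using deriv cont_deriv by blast
  ultimately show ?thesis
    using \<open>bij F\<close> inv by (simp add: global_diffeomorphism_def)
qed

end

corollary global_diffeomorphism_if_Sing_K_infinity_empty:
  fixes F :: "'a::euclidean_space \<Rightarrow> 'a"
  assumes "C1_map F" and sing: "Sing F = {}" and "K_infinity F = {}"
  shows "global_diffeomorphism F"
proof -
  obtain F' :: "'a \<Rightarrow> 'a \<Rightarrow>\<^sub>L 'a" where F': "\<And>x. (F has_derivative F' x) (at x)" "continuous_on UNIV F'"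
    using \<open>C1_map F\<close> unfolding C1_map_def by blast
  have "surj (frechet_derivative F (at x))" for x
    using sing unfolding Sing_def by blast
  then have "surj (F' x)" for x
    by (simp add: frechet_derivative_at[OF F'(1), symmetric])
  then interpret local_diffeo F F'
    using F' by unfold_locales
  show ?thesis
    using assms(3) by (rule global_diffeomorphism_if_K_infinity_empty)
qed

section \<open>Differentiability of polynomial maps\<close>

text \<open>In finite dimension, continuity of the derivative on each fixed vector is continuity in
  operator norm. This form suits computations with sums and products.\<close>

lemma C1_mapI:
  assumes "\<And>x. (F has_derivative D x) (at x)" and "\<And>v. continuous_on UNIV (\<lambda>x. D x v)"
  shows "C1_map F"
proof -
  have bl: "bounded_linear (D x)" for x
    using assms(1) by (rule has_derivative_bounded_linear)
  have "continuous_on UNIV (\<lambda>x. Blinfun (D x))"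
    by (rule continuous_on_blinfun_componentwise) (simp add: bounded_linear_Blinfun_apply[OF bl] assms(2))
  then show ?thesis
    unfolding C1_map_def
    by (intro exI[of _ "\<lambda>x. Blinfun (D x)"]) (simp add: bounded_linear_Blinfun_apply[OF bl] assms(1))
qed

lemma C1_mapE:
  assumes "C1_map F"
  obtains D where "\<And>x. (F has_derivative D x) (at x)" and "\<And>v. continuous_on UNIV (\<lambda>x. D x v)"
proof -
  obtain F' where "\<And>x. (F has_derivative blinfun_apply (F' x)) (at x)" "continuous_on UNIV F'"
    using assms unfolding C1_map_def by blast
  then show ?thesis
    using that[of "\<lambda>x. blinfun_apply (F' x)"] by (simp add: blinfun.continuous_on)
qed

lemma C1_map_differentiable: "C1_map F \<Longrightarrow> F differentiable (at x)"
  by (metis C1_mapE differentiableI)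

lemma C1_map_continuous_on: "C1_map F \<Longrightarrow> continuous_on S F"
  by (intro continuous_at_imp_continuous_on ballI differentiable_imp_continuous_within C1_map_differentiable)

lemma C1_map_bounded_linear: "bounded_linear F \<Longrightarrow> C1_map F"
  by (rule C1_mapI[of F "\<lambda>x. F"]) (auto intro: bounded_linear_imp_has_derivative)

lemma C1_map_const: "C1_map (\<lambda>x. c)"
  by (rule C1_mapI[of _ "\<lambda>x v. 0"]) auto

lemma C1_map_add:
  assumes "C1_map F" "C1_map G"
  shows "C1_map (\<lambda>x. F x + G x)"
proof -
  obtain D E where "\<And>x. (F has_derivative D x) (at x)" "\<And>v. continuous_on UNIV (\<lambda>x. D x v)"
    "\<And>x. (G has_derivative E x) (at x)" "\<And>v. continuous_on UNIV (\<lambda>x. E x v)"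
    using assms by (metis C1_mapE)
  then show ?thesis
    by (intro C1_mapI[of _ "\<lambda>x v. D x v + E x v"] has_derivative_add continuous_intros)
qed

lemma C1_map_mult:
  fixes F G :: "'a::euclidean_space \<Rightarrow> 'b::{euclidean_space, real_normed_algebra}"
  assumes F: "C1_map F" and G: "C1_map G"
  shows "C1_map (\<lambda>x. F x * G x)"
proof -
  obtain D E where "\<And>x. (F has_derivative D x) (at x)" "\<And>v. continuous_on UNIV (\<lambda>x. D x v)"
    "\<And>x. (G has_derivative E x) (at x)" "\<And>v. continuous_on UNIV (\<lambda>x. E x v)"
    using assms by (metis C1_mapE)
  then show ?thesis
    using C1_map_continuous_on[OF F] C1_map_continuous_on[OF G]
    by (intro C1_mapI[of _ "\<lambda>x v. F x * E x v + D x v * G x"] has_derivative_mult continuous_intros)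
qed

lemma C1_map_sum:
  assumes "\<And>i. i \<in> I \<Longrightarrow> C1_map (F i)"
  shows "C1_map (\<lambda>x. \<Sum>i\<in>I. F i x)"
  using assms by (induction I rule: infinite_finite_induct) (simp_all add: C1_map_const C1_map_add)

lemma C1_map_prod:
  fixes F :: "'i \<Rightarrow> 'a::euclidean_space \<Rightarrow> 'b::{euclidean_space, real_normed_algebra_1, comm_ring_1}"
  assumes "\<And>i. i \<in> I \<Longrightarrow> C1_map (F i)"
  shows "C1_map (\<lambda>x. \<Prod>i\<in>I. F i x)"
  using assms by (induction I rule: infinite_finite_induct) (simp_all add: C1_map_const C1_map_mult)

lemma C1_map_power:
  fixes F :: "'a::euclidean_space \<Rightarrow> 'b::{euclidean_space, real_normed_algebra_1, comm_ring_1}"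
  assumes "C1_map F"
  shows "C1_map (\<lambda>x. F x ^ k)"
  using assms by (induction k) (simp_all add: C1_map_const C1_map_mult)

lemma has_derivative_vec_lambda:
  fixes F :: "'n::finite \<Rightarrow> 'a::real_normed_vector \<Rightarrow> 'b::euclidean_space"
  assumes "\<And>j. (F j has_derivative D j) (at x within S)"
  shows "((\<lambda>x. \<chi> j. F j x) has_derivative (\<lambda>v. \<chi> j. D j v)) (at x within S)"
  by (subst has_derivative_componentwise_within)
    (auto simp: Basis_vec_def inner_axis intro!: has_derivative_inner_left assms)

lemma C1_map_vec_lambda:
  fixes F :: "'n::finite \<Rightarrow> 'a::euclidean_space \<Rightarrow> 'b::euclidean_space"
  assumes "\<And>j. C1_map (F j)"
  shows "C1_map (\<lambda>x. \<chi> j. F j x)"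
proof -
  have "\<exists>D. (\<forall>x. (F j has_derivative D x) (at x)) \<and> (\<forall>v. continuous_on UNIV (\<lambda>x. D x v))" for j
    using assms[of j] by (metis C1_mapE)
  then obtain D where "\<And>j x. (F j has_derivative D j x) (at x)"
    "\<And>j v. continuous_on UNIV (\<lambda>x. D j x v)"
    by metis
  then show ?thesis
    by (intro C1_mapI[of _ "\<lambda>x v. \<chi> j. D j x v"] has_derivative_vec_lambda continuous_on_vec_lambda)
qed

lemma C1_map_vec_power:
  fixes F :: "'n::finite \<Rightarrow> 'a::euclidean_space \<Rightarrow> 'b::{euclidean_space, real_normed_algebra_1, comm_ring_1}"
  assumes "\<And>i. C1_map (F i)"
  shows "C1_map (\<lambda>x. vec_power (\<chi> i. F i x) \<nu>)"
  unfolding vec_power_def using assms by (simp add: C1_map_prod C1_map_power)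

section \<open>Dominant exponents of an unbounded sequence\<close>

text \<open>On \<open>span N\<close> the sum on the right is a norm: a vector of the span orthogonal
  to all of \<open>N\<close> is orthogonal to itself. Its minimum on the compact unit sphere of the
  span gives the constant.\<close>

lemma norm_le_sum_inner_on_span:
  fixes N :: "'a::euclidean_space set"
  assumes "finite N"
  obtains C where "C > 0" "\<And>q. q \<in> span N \<Longrightarrow> norm q \<le> C * (\<Sum>u\<in>N. \<bar>q \<bullet> u\<bar>)"
proof -
  define g where "g q = (\<Sum>u\<in>N. \<bar>q \<bullet> u\<bar>)" for q
  have g_nonneg: "0 \<le> g q" for q
    by (simp add: g_def sum_nonneg)
  have pos: "g q > 0" if "q \<in> span N" "q \<noteq> 0" for q
  proof (rule ccontr)
    assume "\<not> g q > 0"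
    then have "g q = 0"
      using g_nonneg[of q] by simp
    then have "\<forall>u\<in>N. q \<bullet> u = 0"
      using assms by (simp add: g_def sum_nonneg_eq_0_iff)
    then have "orthogonal q q"
      using orthogonal_to_span[OF that(1), of q] by (simp add: orthogonal_def)
    then show False
      using that(2) by (simp add: orthogonal_def)
  qed
  have "compact (sphere 0 1 \<inter> span N)"
    by (simp add: closed_subspace compact_Int_closed)
  have "continuous_on (sphere 0 1 \<inter> span N) g"
    unfolding g_def by (intro continuous_intros)
  have "\<exists>c>0. \<forall>q\<in>sphere 0 1 \<inter> span N. c \<le> g q"
  proof (cases "sphere 0 1 \<inter> span N = {}")
    case False
    then obtain q where q: "q \<in> sphere 0 1 \<inter> span N" "\<forall>q'\<in>sphere 0 1 \<inter> span N. g q \<le> g q'"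
      using continuous_attains_inf \<open>compact _\<close> \<open>continuous_on _ g\<close> by blast
    moreover from q(1) have "q \<noteq> 0" "q \<in> span N"
      by auto
    then have "g q > 0"
      by (simp add: pos)
    ultimately show ?thesis by blast
  \<comment> \<open>The sphere of the span is empty when the span is zero; any positive constant
    then serves.\<close>
  qed (auto intro: exI[of _ 1])
  then obtain c where c: "c > 0" "\<And>q. q \<in> sphere 0 1 \<inter> span N \<Longrightarrow> c \<le> g q"
    by blast
  have "norm q \<le> (1 / c) * g q" if "q \<in> span N" for q
  proof (cases "q = 0")
    case False
    have "c \<le> g (q /\<^sub>R norm q)"
      using that False by (intro c(2)) (simp add: span_scale)
    also have "g (q /\<^sub>R norm q) = g q / norm q"
      by (simp add: g_def abs_mult sum_divide_distrib divide_inverse_commute flip: sum_distrib_left)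
    finally show ?thesis
      using False c(1) by (simp add: field_simps)
  qed (simp add: g_def)
  then show ?thesis
    using that[of "1 / c"] c(1) by (simp add: g_def)
qed

text \<open>Induction on \<open>T\<close>: a sequence whose absolute values do not tend to infinity
  has a convergent subsequence, and both alternatives pass to further subsequences.\<close>

lemma convergent_or_unbounded_subseq:
  fixes d :: "'t \<Rightarrow> nat \<Rightarrow> real"
  assumes "finite T"
  obtains r where "strict_mono r"
    "\<And>t. t \<in> T \<Longrightarrow> convergent (d t \<circ> r) \<or> filterlim (\<lambda>l. \<bar>d t (r l)\<bar>) at_top sequentially"
proof -
  have "\<exists>r. strict_mono r \<and> (\<forall>t\<in>T.
      convergent (d t \<circ> r) \<or> filterlim (\<lambda>l. \<bar>d t (r l)\<bar>) at_top sequentially)"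
    using assms
  proof induction
    case empty
    then show ?case
      using strict_mono_id by blast
  next
    case (insert t T)
    then obtain r where r: "strict_mono r"
      "\<And>t. t \<in> T \<Longrightarrow> convergent (d t \<circ> r) \<or> filterlim (\<lambda>l. \<bar>d t (r l)\<bar>) at_top sequentially"
      by blast
    show ?case
    proof (cases "filterlim (\<lambda>l. \<bar>d t (r l)\<bar>) at_top sequentially")
      case True
      then show ?thesis
        using r by blast
    next
      case False
      then obtain s a where s: "strict_mono s" "((d t \<circ> r) \<circ> s) \<longlonglongrightarrow> a"
        using convergent_subseq_if_not_norm_at_top[of "d t \<circ> r"] by (auto simp: o_def)
      have "convergent (d t' \<circ> (r \<circ> s)) \<or> filterlim (\<lambda>l. \<bar>d t' ((r \<circ> s) l)\<bar>) at_top sequentially"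
        if t': "t' \<in> insert t T" for t'
      proof (cases "t' = t")
        case True
        then show ?thesis
          using s(2) by (auto simp: comp_assoc convergent_def)
      next
        case False
        then consider "convergent (d t' \<circ> r)" | "filterlim (\<lambda>l. \<bar>d t' (r l)\<bar>) at_top sequentially"
          using r(2) t' by blast
        then show ?thesis
        proof cases
          case 1
          then show ?thesis
            using convergent_subseq_convergent[OF 1 s(1)] by (simp add: comp_assoc)
        next
          case 2
          then show ?thesis
            using filterlim_compose[OF 2 filterlim_subseq[OF s(1)]] by simp
        qed
      qed
      moreover have "strict_mono (r \<circ> s)"
        using r(1) s(1) by (rule strict_mono_o)
      ultimately show ?thesis by blast
    qed
  qed
  then show ?thesis
    using that by blast
qed

lemma norm_vec_component_gt:
  fixes x :: "'a::real_normed_vector ^ 'n" and B :: real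
  assumes "norm x > CARD('n) * B"
  shows "\<exists>i. norm (x $ i) > B"
proof (rule ccontr)
  assume "\<not> ?thesis"
  then have "(\<Sum>i\<in>UNIV. norm (x $ i)) \<le> (\<Sum>i\<in>(UNIV::'n set). B)"
    by (intro sum_mono) (simp add: not_less)
  moreover have "norm x \<le> (\<Sum>i\<in>UNIV. norm (x $ i))"
    unfolding norm_vec_def by (rule L2_set_le_sum) simp
  ultimately show False
    using assms by simp
qed

text \<open>Here \<open>q l\<close> is the projection of \<open>P l\<close> to the span of the differences of dominant exponents, those in
  \<open>T j\<close>. So \<open>P l - q l\<close> does not distinguish exponents in \<open>T j\<close>, while for large \<open>l\<close> it separates them
  strictly from the others: it is the covector \<open>p\<close> whose faces carry the dominant terms.\<close>

lemma dominant_exponents: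
  fixes P :: "nat \<Rightarrow> 'v::euclidean_space" and V :: "'n::finite \<Rightarrow> 'v set"
  assumes fin: "\<And>j. finite (V j)" and ne: "\<And>j. V j \<noteq> {}"
  obtains r q w T where "strict_mono r" "\<And>j. w j \<in> V j" "bounded (range q)"
    "\<And>l j v. v \<in> V j \<Longrightarrow> P (r l) \<bullet> w j \<le> P (r l) \<bullet> v"
    "\<And>l j v. v \<in> V j \<Longrightarrow> v \<in> T j \<Longrightarrow> P (r l) \<bullet> (v - w j) = q l \<bullet> (v - w j)"
    "\<And>j v. v \<in> V j \<Longrightarrow> v \<notin> T j \<Longrightarrow>
      filterlim (\<lambda>l. P (r l) \<bullet> (v - w j)) at_top sequentially"
proof -
  have "\<exists>v\<in>V j. \<forall>v'\<in>V j. P l \<bullet> v \<le> P l \<bullet> v'" for j l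
    using ex_is_arg_min_if_finite[OF fin ne, of "\<lambda>v. P l \<bullet> v" j]
    by (force simp: is_arg_min_linorder)
  then have "\<forall>l j. \<exists>v. v \<in> V j \<and> (\<forall>v'\<in>V j. P l \<bullet> v \<le> P l \<bullet> v')"
    by blast
  then obtain m where m: "\<And>l j. m l j \<in> V j" "\<And>l j v. v \<in> V j \<Longrightarrow> P l \<bullet> m l j \<le> P l \<bullet> v"
    unfolding choice_iff by blast
  \<comment> \<open>There are finitely many systems of minimizers, so one of them occurs for
    infinitely many \<open>l\<close>; it becomes \<open>w\<close>.\<close>
  have "range m \<subseteq> PiE UNIV V"
    using m(1) by auto
  then have "finite (range m)"
    by (rule finite_subset) (simp add: finite_PiE fin)
  then obtain l0 where "infinite {l. m l = m l0}"
    using pigeonhole_infinite[of "UNIV :: nat set" m] by auto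
  then obtain r1 :: "nat \<Rightarrow> nat" where r1: "strict_mono r1" "\<And>l. m (r1 l) = m l0"
    using infinite_enumerate by (metis (mono_tags) mem_Collect_eq)
  define w where "w = m l0"
  have w: "w j \<in> V j" "v \<in> V j \<Longrightarrow> P (r1 l) \<bullet> w j \<le> P (r1 l) \<bullet> v" for j v l
    using m(1)[of l0 j] m(2)[of v j "r1 l"] r1(2)[of l] by (auto simp: w_def)
  define d where "d = (\<lambda>(j, v) l. P (r1 l) \<bullet> (v - w j))"
  have "finite (Sigma UNIV V)"
    by (simp add: fin)
  then obtain r2 where r2: "strict_mono r2" "\<And>t. t \<in> Sigma UNIV V \<Longrightarrow>
      convergent (d t \<circ> r2) \<or> filterlim (\<lambda>l. \<bar>d t (r2 l)\<bar>) at_top sequentially"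
    by (rule convergent_or_unbounded_subseq[where d = d]) blast
  define r where "r = r1 \<circ> r2"
  \<comment> \<open>Along \<open>r\<close>, the gap to the minimum either converges or tends to
    infinity; \<open>T j\<close> consists of the exponents with convergent gap.\<close>
  define T where "T j = {v \<in> V j. convergent (\<lambda>l. P (r l) \<bullet> (v - w j))}" for j
  define N where "N = (\<Union>j. (\<lambda>v. v - w j) ` T j)"
  have "finite N"
    using fin by (auto simp: N_def T_def)
  then obtain C where C: "C > 0" "\<And>q. q \<in> span N \<Longrightarrow> norm q \<le> C * (\<Sum>u\<in>N. \<bar>q \<bullet> u\<bar>)"
    by (rule norm_le_sum_inner_on_span) blast
  have "\<exists>q. q \<in> span N \<and> (\<forall>u\<in>N. P (r l) \<bullet> u = q \<bullet> u)" for l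
  proof -
    obtain y z where yz: "y \<in> span N" "\<And>u. u \<in> span N \<Longrightarrow> orthogonal z u" "P (r l) = y + z"
      using orthogonal_subspace_decomp_exists[of N "P (r l)"] by metis
    then show ?thesis
      by (intro exI[of _ y]) (simp add: inner_add_left orthogonal_def span_base)
  qed
  then obtain q where q: "\<And>l. q l \<in> span N" "\<And>l u. u \<in> N \<Longrightarrow> P (r l) \<bullet> u = q l \<bullet> u"
    by metis
  \<comment> \<open>Convergent gaps are bounded, and on \<open>span N\<close> they control the norm
    of the projection \<open>q\<close>.\<close>
  have "\<exists>B. \<forall>l. \<bar>P (r l) \<bullet> u\<bar> \<le> B" if "u \<in> N" for u
  proof -
    have "convergent (\<lambda>l. P (r l) \<bullet> u)"
      using that by (auto simp: N_def T_def)
    then have "Bseq (\<lambda>l. P (r l) \<bullet> u)"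
      by (rule convergent_imp_Bseq)
    then show ?thesis
      by (auto simp: Bseq_def)
  qed
  then obtain B where B: "\<And>u l. u \<in> N \<Longrightarrow> \<bar>P (r l) \<bullet> u\<bar> \<le> B u"
    by metis
  have "norm (q l) \<le> C * (\<Sum>u\<in>N. B u)" for l
  proof -
    have "norm (q l) \<le> C * (\<Sum>u\<in>N. \<bar>q l \<bullet> u\<bar>)"
      using C(2) q(1) by blast
    also have "\<dots> \<le> C * (\<Sum>u\<in>N. B u)"
      using C(1) B q(2) by (intro mult_left_mono sum_mono) (metis, simp)
    finally show ?thesis .
  qed
  then have "bounded (range q)"
    by (auto simp: bounded_iff)
  moreover have "strict_mono r"
    unfolding r_def using r1(1) r2(1) by (rule strict_mono_o)
  moreover have "filterlim (\<lambda>l. P (r l) \<bullet> (v - w j)) at_top sequentially" if "v \<in> V j" "v \<notin> T j" for j v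
  proof -
    have "\<not> convergent (d (j, v) \<circ> r2)"
      using that by (simp add: T_def d_def r_def o_def)
    then have "filterlim (\<lambda>l. \<bar>d (j, v) (r2 l)\<bar>) at_top sequentially"
      using r2(2)[of "(j, v)"] that(1) by blast
    moreover have "\<bar>d (j, v) (r2 l)\<bar> = P (r l) \<bullet> (v - w j)" for l
      using w(2)[OF that(1), of "r2 l"] by (simp add: d_def r_def inner_diff_right)
    ultimately show ?thesis by simp
  qed
  moreover have "P (r l) \<bullet> (v - w j) = q l \<bullet> (v - w j)" if "v \<in> T j" for l j v
    using that by (intro q(2)) (auto simp: N_def)
  ultimately show ?thesis
    using that[of r w q T] w by (simp add: r_def)
qed

section \<open>Faces and cones\<close>

text \<open>A half-space containing the generators contains their convex hull, so the minimum over
  \<open>Gamma0 S\<close> is the one over the finitely or infinitely many generators.\<close>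

lemma mem_min_face_iff:
  assumes w: "w \<in> insert 0 (real_vec ` S)" and "\<And>v. v \<in> insert 0 (real_vec ` S) \<Longrightarrow> p \<bullet> w \<le> p \<bullet> v"
    and v: "v \<in> insert 0 (real_vec ` S)"
  shows "v \<in> min_face S p \<longleftrightarrow> p \<bullet> v = p \<bullet> w"
proof -
  have "Gamma0 S \<subseteq> {z. p \<bullet> z \<ge> p \<bullet> w}"
    unfolding Gamma0_def using assms(2) by (intro hull_minimal convex_halfspace_ge) blast
  then have lower: "\<And>z. z \<in> Gamma0 S \<Longrightarrow> p \<bullet> w \<le> p \<bullet> z"
    by blast
  have mem: "v \<in> Gamma0 S" "w \<in> Gamma0 S"
    unfolding Gamma0_def using v w by (simp_all only: hull_inc)
  show ?thesis
  proof
    assume "v \<in> min_face S p"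
    then have "p \<bullet> v \<le> p \<bullet> w"
      using mem(2) by (simp add: min_face_def)
    then show "p \<bullet> v = p \<bullet> w"
      using lower[OF mem(1)] by simp
  next
    assume "p \<bullet> v = p \<bullet> w"
    then show "v \<in> min_face S p"
      using mem(1) lower by (simp add: min_face_def)
  qed
qed

lemma inner_eq_on_min_face: "v \<in> min_face S p \<Longrightarrow> w \<in> min_face S p \<Longrightarrow> p \<bullet> v = p \<bullet> w"
  by (rule order_antisym) (simp_all add: min_face_def)

lemma inner_real_vec_axis:
  assumes "\<nu> \<in> coordinate_axis i"
  shows "p \<bullet> real_vec \<nu> = p $ i * real (\<nu> $ i)"
proof -
  have "p \<bullet> real_vec \<nu> = (\<Sum>k\<in>UNIV. if k = i then p $ k * real (\<nu> $ k) else 0)"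
    unfolding inner_vec_def real_vec_def
    using assms by (intro sum.cong) (auto simp: coordinate_axis_def)
  then show ?thesis
    by simp
qed

lemma axis_component_pos:
  assumes "\<nu> \<in> coordinate_axis i" "\<nu> \<noteq> 0"
  shows "\<nu> $ i > 0"
proof (rule ccontr)
  assume "\<not> \<nu> $ i > 0"
  then have "\<nu> $ k = 0" for k
    using assms(1) by (cases "k = i") (auto simp: coordinate_axis_def)
  then show False
    using assms(2) by (simp add: vec_eq_iff)
qed

text \<open>On an axis where \<open>p\<close> is negative, convenience supplies a nonzero exponent
  with negative value, below the value 0 at the origin.\<close>

lemma zero_notin_min_face:
  assumes "p \<in> dual_domain" and conv: "convenient S" and "0 \<notin> S"
  shows "0 \<notin> min_face S p"
proof
  assume 0: "0 \<in> min_face S p"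
  obtain i where i: "p $ i < 0"
    using assms(1) by (auto simp: dual_domain_def not_le)
  obtain \<nu> where \<nu>: "\<nu> \<in> S" "\<nu> \<in> coordinate_axis i"
    using conv unfolding convenient_def by blast
  have "\<nu> \<noteq> 0"
    using \<nu>(1) assms(3) by auto
  have "real_vec \<nu> \<in> Gamma0 S"
    unfolding Gamma0_def using \<nu>(1) by (blast intro: hull_inc)
  then have "0 \<le> p \<bullet> real_vec \<nu>"
    using 0 by (auto simp: min_face_def)
  moreover have "p \<bullet> real_vec \<nu> < 0"
    using i axis_component_pos[OF \<nu>(2) \<open>\<nu> \<noteq> 0\<close>] by (simp add: inner_real_vec_axis[OF \<nu>(2)] mult_neg_pos)
  ultimately show False by simp
qed

text \<open>The cone through \<open>p\<close> lies in one equivalence class, so the representative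
  picked by \<open>SOME\<close> has the same faces as \<open>p\<close>.\<close>

lemma dual_subdivision_cone_face:
  assumes "dual_subdivision S C" "p \<in> dual_domain"
  obtains \<sigma> where "\<sigma> \<in> C" "\<And>j. cone_face (S j) \<sigma> = min_face (S j) p"
proof -
  have ref: "partition_on dual_domain C" "\<forall>\<sigma>\<in>C. \<exists>Y\<in>dual_domain // face_equiv S. \<sigma> \<subseteq> Y"
    using assms(1) by (auto simp: dual_subdivision_def refines_def)
  then obtain \<sigma> where \<sigma>: "\<sigma> \<in> C" "p \<in> \<sigma>"
    using assms(2) partition_onD1 by blast
  then obtain p0 where "\<sigma> \<subseteq> face_equiv S `` {p0}"
    using ref(2) by (auto elim!: quotientE)
  then have "min_face (S j) p0 = min_face (S j) p'" if "p' \<in> \<sigma>" for p' j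
    using that by (auto simp: face_equiv_def)
  moreover have "(SOME p. p \<in> \<sigma>) \<in> \<sigma>"
    using \<sigma>(2) by (rule someI)
  ultimately have "cone_face (S j) \<sigma> = min_face (S j) p" for j
    using \<sigma>(2) unfolding cone_face_def by metis
  then show ?thesis
    using that \<sigma>(1) by blast
qed

section \<open>Sums of quasi-homogeneous terms\<close>

text \<open>Real, complex and mixed polynomial maps at once: all that matters is how the terms
  \<open>m j k\<close> behave under scaling of the coordinates by positive real numbers.\<close>

locale quasihomogeneous_sums =
  fixes K :: "'n::finite \<Rightarrow> 'k set" and e :: "'k \<Rightarrow> nat ^ 'n"
    and m :: "'n \<Rightarrow> 'k \<Rightarrow> 'a::euclidean_space ^ 'n \<Rightarrow> 'a"
  assumes finite_K: "finite (K j)"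
    and C1_m: "C1_map (m j k)"
    and scale: "m j k (\<chi> i. exp (t $ i) *\<^sub>R x $ i) = exp (t \<bullet> real_vec (e k)) *\<^sub>R m j k x"
    and convenient_K: "convenient (e ` K j)"
    and zero_notin: "0 \<notin> e ` K j"
begin

definition F :: "'a ^ 'n \<Rightarrow> 'a ^ 'n" where
  "F x = (\<chi> j. \<Sum>k\<in>K j. m j k x)"

definition face :: "'n \<Rightarrow> (real ^ 'n) set \<Rightarrow> 'a ^ 'n \<Rightarrow> 'a" where
  "face j \<Delta> x = (\<Sum>k\<in>{k \<in> K j. real_vec (e k) \<in> \<Delta>}. m j k x)"

definition supp :: "'n \<Rightarrow> (nat ^ 'n) set" where
  "supp j = e ` K j"

lemma C1_F: "C1_map F"
  unfolding F_def[abs_def] by (rule C1_map_vec_lambda) (rule C1_map_sum, rule C1_m)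

lemma C1_face: "C1_map (face j \<Delta>)"
  unfolding face_def[abs_def] by (rule C1_map_sum) (rule C1_m)

lemma tendsto_m: "(f \<longlongrightarrow> x) G \<Longrightarrow> ((\<lambda>t. m j k (f t)) \<longlongrightarrow> m j k x) G"
  by (rule isCont_tendsto_compose[OF differentiable_imp_continuous_within[OF C1_map_differentiable[OF C1_m]]])

text \<open>Euler's relation: the derivative of the faces at a common zero vanishes on the tangent
  vector of the orbit of the one-parameter group with weights \<open>p\<close>.\<close>

lemma Sing_family_face:
  assumes "p \<noteq> 0" and a: "\<And>i. a $ i \<noteq> 0" and zero: "\<And>j. face j (\<Delta> j) a = 0"
    and eq: "\<And>j v w. v \<in> \<Delta> j \<Longrightarrow> w \<in> \<Delta> j \<Longrightarrow> p \<bullet> v = p \<bullet> w"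
  shows "a \<in> Sing_family UNIV (\<lambda>j. face j (\<Delta> j))"
proof -
  \<comment> \<open>\<open>c\<close> is the orbit of \<open>a\<close> under the scaling group with
    weights \<open>p\<close>, and \<open>h\<close> is its velocity at time 0.\<close>
  define c where "c t = (\<chi> i. exp (t * p $ i) *\<^sub>R a $ i)" for t
  define h where "h = (\<chi> i. p $ i *\<^sub>R a $ i)"
  define D where "D j = frechet_derivative (face j (\<Delta> j)) (at a)" for j
  have D: "(face j (\<Delta> j) has_derivative D j) (at a)" for j
    unfolding D_def using C1_map_differentiable[OF C1_face] by (simp add: frechet_derivative_works)
  have face_c: "face j (\<Delta> j) (c t) = 0" for j t
  proof -
    \<comment> \<open>\<open>p\<close> is constant on the face, so all terms scale by the same
      factor and the orbit stays in the zero set.\<close>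
    obtain d where d: "\<And>v. v \<in> \<Delta> j \<Longrightarrow> p \<bullet> v = d"
      using eq by metis
    have "m j k (c t) = exp (t * d) *\<^sub>R m j k a" if "real_vec (e k) \<in> \<Delta> j" for k
      using scale[of j k "t *\<^sub>R p" a] d[OF that] by (simp add: c_def)
    then have "face j (\<Delta> j) (c t) = exp (t * d) *\<^sub>R face j (\<Delta> j) a"
      by (simp add: face_def scaleR_sum_right)
    then show ?thesis
      by (simp add: zero)
  qed
  have c0: "c 0 = a"
    by (simp add: c_def)
  have "(c has_derivative (\<lambda>s. \<chi> i. s *\<^sub>R (p $ i *\<^sub>R a $ i))) (at 0)"
    unfolding c_def by (rule has_derivative_vec_lambda) (auto intro!: derivative_eq_intros)
  then have "((\<lambda>t. face j (\<Delta> j) (c t)) has_derivative (\<lambda>s. D j (\<chi> i. s *\<^sub>R (p $ i *\<^sub>R a $ i)))) (at 0)" for j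
    by (rule has_derivative_compose) (simp add: c0 D)
  then have "((\<lambda>t. 0) has_derivative (\<lambda>s. D j (\<chi> i. s *\<^sub>R (p $ i *\<^sub>R a $ i)))) (at 0)" for j
    unfolding face_c .
  then have D0: "(\<lambda>s. D j (\<chi> i. s *\<^sub>R (p $ i *\<^sub>R a $ i))) = (\<lambda>s. 0)" for j
    by (rule has_derivative_unique) (rule has_derivative_const)
  have Dh: "D j h = 0" for j
    using fun_cong[OF D0[of j], of 1] by (simp add: h_def)
  have "h \<noteq> 0"
    using \<open>p \<noteq> 0\<close> a by (auto simp: h_def vec_eq_iff)
  \<comment> \<open>\<open>L\<close> stacks all the differentials into a square system; the common
    kernel vector \<open>h\<close> rules out injectivity, hence surjectivity.\<close>
  define L where "L v = (\<chi> j. D j v)" for v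
  have linD: "linear (D j)" for j
    using D has_derivative_linear by blast
  have "linear L"
    by (rule linearI) (simp_all add: L_def vec_eq_iff linear_add[OF linD] linear_cmul[OF linD])
  moreover have "\<not> inj L"
  proof
    assume "inj L"
    moreover have "L h = L 0"
      by (simp add: L_def Dh linear_0[OF linD])
    ultimately show False
      using \<open>h \<noteq> 0\<close> by (simp add: inj_eq)
  qed
  ultimately have "\<not> surj L"
    using linear_surjective_imp_injective by blast
  then obtain y where y: "\<And>v. L v \<noteq> y"
    by (metis surjI)
  have "(\<lambda>j\<in>UNIV. y $ j) \<notin> range (\<lambda>v. \<lambda>j\<in>UNIV. D j v)"
  proof
    assume "(\<lambda>j\<in>UNIV. y $ j) \<in> range (\<lambda>v. \<lambda>j\<in>UNIV. D j v)"
    then obtain v where v: "(\<lambda>j\<in>UNIV. y $ j) = (\<lambda>j\<in>UNIV. D j v)" by blast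
    have "y $ j = D j v" for j
      using fun_cong[OF v, of j] by simp
    then have "L v = y"
      by (simp add: L_def vec_eq_iff)
    then show False
      using y by blast
  qed
  moreover have "(\<lambda>j\<in>UNIV. y $ j) \<in> (UNIV \<rightarrow>\<^sub>E UNIV)"
    by simp
  ultimately have "range (\<lambda>v. \<lambda>j\<in>UNIV. D j v) \<noteq> (UNIV \<rightarrow>\<^sub>E UNIV)"
    by blast
  then show ?thesis
    by (simp add: Sing_family_def D_def)
qed

text \<open>Multiplied by \<open>exp (R l \<bullet> w j)\<close>, the dominant terms of component
  \<open>j\<close> converge and the others vanish, which leaves a positive multiple of its face at
  \<open>a\<close>. The same product tends to 0, since the component stays bounded and, by
  convenience, the factor tends to 0.\<close>

lemma face_zero_if_bounded_sequence:
  assumes x: "\<And>l i. x l $ i \<noteq> 0" and unbdd: "filterlim (\<lambda>l. norm (x l)) at_top sequentially"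
    and lim: "(\<lambda>l. F (x l)) \<longlonglongrightarrow> c"
  obtains p a where "p \<in> dual_domain" "\<And>i. a $ i \<noteq> 0" "\<And>j. face j (min_face (supp j) p) a = 0"
proof -
  \<comment> \<open>With the minus sign, a term of exponent \<open>v\<close> has order
    \<open>exp (- P l \<bullet> v)\<close>: the largest terms are those on which the covector is
    minimal.\<close>
  define P where "P l = (\<chi> i. - ln (norm (x l $ i)))" for l
  define V where "V j = insert 0 (real_vec ` supp j)" for j
  have "finite (V j)" "V j \<noteq> {}" for j
    using finite_K by (auto simp: V_def supp_def)
  then obtain r q w T where r: "strict_mono r" and w: "\<And>j. w j \<in> V j" and bdd: "bounded (range q)"
    and min: "\<And>l j v. v \<in> V j \<Longrightarrow> P (r l) \<bullet> w j \<le> P (r l) \<bullet> v"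
    and T: "\<And>l j v. v \<in> V j \<Longrightarrow> v \<in> T j \<Longrightarrow> P (r l) \<bullet> (v - w j) = q l \<bullet> (v - w j)"
    and notT: "\<And>j v. v \<in> V j \<Longrightarrow> v \<notin> T j \<Longrightarrow>
      filterlim (\<lambda>l. P (r l) \<bullet> (v - w j)) at_top sequentially"
    by (rule dominant_exponents[where V = V and P = P]) (rule that)
  obtain B where B: "\<And>l. norm (q l) \<le> B"
    using bdd by (auto simp: bounded_iff)
  define y where "y l = x (r l)" for l
  define R where "R l = P (r l)" for l
  \<comment> \<open>Coordinatewise polar decomposition: moduli are recorded by \<open>R\<close>,
    directions by \<open>\<sigma>\<close>.\<close>
  define \<sigma> where "\<sigma> l = (\<chi> i. sgn (y l $ i))" for l
  have norm_\<sigma>: "norm (\<sigma> l $ i) = 1" for l i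
    using x by (simp add: \<sigma>_def y_def norm_sgn)
  have y_eq: "y l = (\<chi> i. exp ((- R l) $ i) *\<^sub>R \<sigma> l $ i)" for l
    using x by (simp add: vec_eq_iff R_def P_def \<sigma>_def y_def sgn_div_norm)
  have large: "\<forall>\<^sub>F l in sequentially. \<exists>i. R l $ i < - M" for M
  proof -
    have "filterlim (\<lambda>l. norm (y l)) at_top sequentially"
      unfolding y_def using unbdd filterlim_subseq[OF r] by (rule filterlim_compose)
    then have "\<forall>\<^sub>F l in sequentially. norm (y l) > CARD('n) * exp M"
      by (simp add: filterlim_at_top_dense)
    then show ?thesis
    proof eventually_elim
      case (elim l)
      then obtain i where "norm (y l $ i) > exp M"
        using norm_vec_component_gt by blast
      then have "ln (norm (y l $ i)) > M"
        by (metis exp_gt_zero exp_less_cancel_iff exp_ln less_trans)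
      then show ?case
        by (auto simp: R_def P_def y_def)
    qed
  qed
  have sep: "\<forall>\<^sub>F l in sequentially. (R l - q l) \<bullet> (v - w j) > 0" if "v \<in> V j" "v \<notin> T j" for j v
  proof -
    have "\<forall>\<^sub>F l in sequentially. R l \<bullet> (v - w j) > B * norm (v - w j)"
      using notT[OF that] by (simp add: filterlim_at_top_dense R_def)
    then show ?thesis
    proof eventually_elim
      case (elim l)
      have "q l \<bullet> (v - w j) \<le> norm (q l) * norm (v - w j)"
        by (rule norm_cauchy_schwarz)
      also have "\<dots> \<le> B * norm (v - w j)"
        using B by (intro mult_right_mono) auto
      finally show ?case
        using elim by (simp add: inner_diff_left)
    qed
  qed
  have "finite (Sigma UNIV (\<lambda>j. V j - T j))"
    using finite_K by (simp add: V_def supp_def)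
  then have "\<forall>\<^sub>F l in sequentially. \<forall>t\<in>Sigma UNIV (\<lambda>j. V j - T j). (R l - q l) \<bullet> (snd t - w (fst t)) > 0"
    by (rule eventually_ball_finite) (auto intro: sep)
  with large[of B] have "\<forall>\<^sub>F l in sequentially. (\<exists>i. R l $ i < - B) \<and>
      (\<forall>t\<in>Sigma UNIV (\<lambda>j. V j - T j). (R l - q l) \<bullet> (snd t - w (fst t)) > 0)"
    by (rule eventually_conj)
  \<comment> \<open>A single late index suffices to define \<open>p\<close>:
    \<open>R l0 - q l0\<close> separates the dominant exponents, and since \<open>q\<close> is
    bounded by \<open>B\<close> it keeps a negative coordinate.\<close>
  then obtain l0 i0 where l0: "R l0 $ i0 < - B"
    and pos: "\<And>j v. v \<in> V j \<Longrightarrow> v \<notin> T j \<Longrightarrow> (R l0 - q l0) \<bullet> (v - w j) > 0"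
    using eventually_happens'[OF sequentially_bot] by fastforce
  define p where "p = R l0 - q l0"
  have "\<bar>q l0 $ i0\<bar> \<le> B"
    using component_le_norm_cart[of "q l0" i0] B[of l0] by linarith
  then have "p $ i0 < 0"
    using l0 by (simp add: p_def)
  then have p: "p \<in> dual_domain"
    unfolding dual_domain_def using not_le by blast
  have pT: "p \<bullet> v = p \<bullet> w j" if "v \<in> V j" "v \<in> T j" for v j
    using T[OF that, of l0] by (simp add: p_def R_def inner_diff_left inner_diff_right)
  have p_notT: "p \<bullet> w j < p \<bullet> v" if "v \<in> V j" "v \<notin> T j" for v j
    using pos[OF that] by (simp add: p_def inner_diff_right)
  have face_iff: "v \<in> min_face (supp j) p \<longleftrightarrow> v \<in> T j" if v: "v \<in> V j" for v j
  proof -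
    have "p \<bullet> w j \<le> p \<bullet> u" if "u \<in> V j" for u
      using pT[OF that] p_notT[OF that] by fastforce
    then have "v \<in> min_face (supp j) p \<longleftrightarrow> p \<bullet> v = p \<bullet> w j"
      using w[of j] v unfolding V_def by (intro mem_min_face_iff) auto
    then show ?thesis
      using pT[OF v] p_notT[OF v] by fastforce
  qed
  have mem: "(q l, \<sigma> l) \<in> cball 0 B \<times> cball 0 (CARD('n))" for l
  proof -
    have "norm (\<sigma> l) \<le> (\<Sum>i\<in>UNIV. norm (\<sigma> l $ i))"
      unfolding norm_vec_def by (rule L2_set_le_sum) simp
    then show ?thesis
      using B by (simp add: norm_\<sigma>)
  qed
  have "compact (cball (0 :: real ^ 'n) B \<times> cball (0 :: 'a ^ 'n) (CARD('n)))"
    by (intro compact_Times compact_cball)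
  then obtain z s where s: "strict_mono s" and z: "((\<lambda>l. (q l, \<sigma> l)) \<circ> s) \<longlonglongrightarrow> z"
    by (rule seq_compactE[OF compact_imp_seq_compact allI[OF mem]]) (rule that)
  obtain q0 \<sigma>0 where "z = (q0, \<sigma>0)"
    by fastforce
  then have q0: "(\<lambda>l. q (s l)) \<longlonglongrightarrow> q0" and \<sigma>0: "(\<lambda>l. \<sigma> (s l)) \<longlonglongrightarrow> \<sigma>0"
    using tendsto_fst[OF z] tendsto_snd[OF z] by (simp_all add: o_def)
  have "norm (\<sigma>0 $ i) = 1" for i
    using tendsto_norm[OF tendsto_vec_nth[OF \<sigma>0, of i]] by (simp add: norm_\<sigma> LIMSEQ_const_iff)
  then have \<sigma>0_nz: "\<sigma>0 $ i \<noteq> 0" for i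
    by (metis norm_zero zero_neq_one)
  \<comment> \<open>The part \<open>q\<close> of the logarithms that survives rescaling gives the
    moduli of the limit point.\<close>
  define a where "a = (\<chi> i. exp ((- q0) $ i) *\<^sub>R \<sigma>0 $ i)"
  have a: "a $ i \<noteq> 0" for i
    using \<sigma>0_nz by (simp add: a_def)
  have "face j (min_face (supp j) p) a = 0" for j
  proof -
    let ?\<Delta> = "min_face (supp j) p"
    define g where "g k l = exp (R (s l) \<bullet> w j) *\<^sub>R m j k (y (s l))" for k l
    have g_eq: "g k l = exp (- (R (s l) \<bullet> (real_vec (e k) - w j))) *\<^sub>R m j k (\<sigma> (s l))" for k l
      unfolding g_def y_eq scale by (simp add: inner_diff_right exp_diff exp_minus divide_inverse mult.commute)
    have g_lim: "g k \<longlonglongrightarrow> (if real_vec (e k) \<in> ?\<Delta> then exp (q0 \<bullet> w j) *\<^sub>R m j k a else 0)"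
      if "k \<in> K j" for k
    proof -
      have v: "real_vec (e k) \<in> V j"
        using that by (simp add: V_def supp_def)
      show ?thesis
      proof (cases "real_vec (e k) \<in> T j")
        case True
        have "g k = (\<lambda>l. exp (- (q (s l) \<bullet> (real_vec (e k) - w j))) *\<^sub>R m j k (\<sigma> (s l)))"
          using T[OF v True] by (simp add: fun_eq_iff g_eq R_def)
        moreover have "(\<lambda>l. exp (- (q (s l) \<bullet> (real_vec (e k) - w j))) *\<^sub>R m j k (\<sigma> (s l)))
            \<longlonglongrightarrow> exp (- (q0 \<bullet> (real_vec (e k) - w j))) *\<^sub>R m j k \<sigma>0"
          by (intro tendsto_intros tendsto_m q0 \<sigma>0)
        moreover have "exp (- (q0 \<bullet> (real_vec (e k) - w j))) *\<^sub>R m j k \<sigma>0 = exp (q0 \<bullet> w j) *\<^sub>R m j k a"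
          unfolding a_def scale by (simp add: inner_diff_right exp_diff exp_minus divide_inverse mult.commute)
        ultimately show ?thesis
          using True face_iff[OF v] by simp
      next
        case False
        have "filterlim (\<lambda>l. R (s l) \<bullet> (real_vec (e k) - w j)) at_top sequentially"
          unfolding R_def using notT[OF v False] filterlim_subseq[OF s] by (rule filterlim_compose)
        then have "(\<lambda>l. exp (- (R (s l) \<bullet> (real_vec (e k) - w j)))) \<longlonglongrightarrow> 0"
          by (intro filterlim_compose[OF exp_at_bot]) (simp add: filterlim_uminus_at_top)
        from tendsto_scaleR[OF this tendsto_m[OF \<sigma>0]]
        have "g k \<longlonglongrightarrow> 0"
          by (simp add: g_eq[abs_def])
        then show ?thesis
          using False face_iff[OF v] by simp
      qed
    qed
    have "(\<lambda>l. \<Sum>k\<in>K j. g k l) \<longlonglongrightarrow>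
        (\<Sum>k\<in>K j. if real_vec (e k) \<in> ?\<Delta> then exp (q0 \<bullet> w j) *\<^sub>R m j k a else 0)"
      by (rule tendsto_sum) (rule g_lim)
    also have "(\<Sum>k\<in>K j. if real_vec (e k) \<in> ?\<Delta> then exp (q0 \<bullet> w j) *\<^sub>R m j k a else 0) =
        exp (q0 \<bullet> w j) *\<^sub>R face j ?\<Delta> a"
      using finite_K by (auto simp: face_def scaleR_sum_right sum.inter_filter intro!: sum.cong)
    finally have lim1: "(\<lambda>l. \<Sum>k\<in>K j. g k l) \<longlonglongrightarrow> exp (q0 \<bullet> w j) *\<^sub>R face j ?\<Delta> a" .
    \<comment> \<open>\<open>w j\<close> does at least as well as an exponent on an axis where the
      sequence is large, and convenience provides such an exponent for every axis.\<close>
    have "filterlim (\<lambda>l. R l \<bullet> w j) at_bot sequentially"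
      unfolding filterlim_at_bot_le[of _ _ 0]
    proof (intro allI impI)
      \<comment> \<open>For \<open>M \<le> 0\<close> the coordinate below \<open>M\<close> is
        negative, and multiplying it by an exponent at least 1 only lowers it.\<close>
      fix M :: real assume "M \<le> 0"
      show "\<forall>\<^sub>F l in sequentially. R l \<bullet> w j \<le> M"
        using large[of "- M"]
      proof eventually_elim
        case (elim l)
        then obtain i where i: "R l $ i < M" by auto
        obtain k where k: "k \<in> K j" "e k \<in> coordinate_axis i"
          using convenient_K[of j] unfolding convenient_def by blast
        have "e k \<noteq> 0"
          using zero_notin k(1) by (metis imageI)
        then have "e k $ i \<ge> 1"
          using axis_component_pos[OF k(2)] by simp
        then have "R l $ i * real (e k $ i) \<le> R l $ i * 1"
          using i \<open>M \<le> 0\<close> by (intro mult_left_mono_neg) auto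
        moreover have "R l \<bullet> w j \<le> R l \<bullet> real_vec (e k)"
          unfolding R_def using k(1) by (intro min) (simp add: V_def supp_def)
        ultimately show ?case
          using i by (simp add: inner_real_vec_axis[OF k(2)])
      qed
    qed
    then have "filterlim (\<lambda>l. R (s l) \<bullet> w j) at_bot sequentially"
      using filterlim_subseq[OF s] by (rule filterlim_compose)
    then have "(\<lambda>l. exp (R (s l) \<bullet> w j)) \<longlonglongrightarrow> 0"
      by (rule filterlim_compose[OF exp_at_bot])
    moreover have "(\<lambda>l. F (y (s l)) $ j) \<longlonglongrightarrow> c $ j"
      using LIMSEQ_subseq_LIMSEQ[OF lim strict_mono_o[OF r s]]
      by (intro tendsto_vec_nth) (simp add: y_def o_def)
    ultimately have "(\<lambda>l. exp (R (s l) \<bullet> w j) *\<^sub>R F (y (s l)) $ j) \<longlonglongrightarrow> 0 *\<^sub>R c $ j"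
      by (rule tendsto_scaleR)
    moreover have "exp (R (s l) \<bullet> w j) *\<^sub>R F (y (s l)) $ j = (\<Sum>k\<in>K j. g k l)" for l
      by (simp add: F_def g_def scaleR_sum_right)
    ultimately have "exp (q0 \<bullet> w j) *\<^sub>R face j ?\<Delta> a = 0"
      using LIMSEQ_unique[OF lim1] by simp
    then show ?thesis by simp
  qed
  then show ?thesis
    using that p a by blast
qed

text \<open>Logarithms of the coordinates require points of the torus. Adding a small multiple of
  \<open>z\<close>, which is nonzero exactly on the vanishing coordinates of \<open>x\<close>, moves
  into the torus at arbitrarily small cost.\<close>

lemma perturb_nonzero:
  assumes "\<epsilon> > 0"
  shows "\<exists>y. (\<forall>i. y $ i \<noteq> 0) \<and> dist y x < \<epsilon> \<and> dist (F y) (F x) < \<epsilon>"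
proof -
  obtain b :: 'a where "b \<in> Basis"
    using nonempty_Basis by blast
  then have "b \<noteq> 0"
    by (rule nonzero_Basis)
  define z where "z = (\<chi> i. if x $ i = 0 then b else 0)"
  have "((\<lambda>s. x + s *\<^sub>R z) \<longlongrightarrow> x + 0 *\<^sub>R z) (at 0)"
    by (intro tendsto_intros)
  then have lim: "((\<lambda>s. x + s *\<^sub>R z) \<longlongrightarrow> x) (at 0)"
    by simp
  have "isCont F x"
    by (rule differentiable_imp_continuous_within[OF C1_map_differentiable[OF C1_F]])
  then have "((\<lambda>s. F (x + s *\<^sub>R z)) \<longlongrightarrow> F x) (at 0)"
    using lim by (rule isCont_tendsto_compose)
  then have "\<forall>\<^sub>F s in at 0. dist (F (x + s *\<^sub>R z)) (F x) < \<epsilon>"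
    using assms by (rule tendstoD)
  moreover have "\<forall>\<^sub>F s in at 0. dist (x + s *\<^sub>R z) x < \<epsilon>"
    using lim assms by (rule tendstoD)
  moreover have "\<forall>\<^sub>F s in at (0::real). s \<noteq> 0"
    by (simp add: eventually_at_filter)
  ultimately have "\<forall>\<^sub>F s in at (0::real). dist (F (x + s *\<^sub>R z)) (F x) < \<epsilon> \<and> dist (x + s *\<^sub>R z) x < \<epsilon> \<and> s \<noteq> 0"
    by (intro eventually_conj)
  then obtain s :: real where "dist (F (x + s *\<^sub>R z)) (F x) < \<epsilon>" "dist (x + s *\<^sub>R z) x < \<epsilon>" "s \<noteq> 0"
    using eventually_happens'[OF at_neq_bot] by blast
  moreover have "(x + s *\<^sub>R z) $ i \<noteq> 0" for i
    using \<open>s \<noteq> 0\<close> \<open>b \<noteq> 0\<close> by (simp add: z_def)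
  ultimately show ?thesis by blast
qed

text \<open>A sequence defining a point of \<open>K_infinity F\<close> is moved into the torus and
  yields a common zero \<open>a\<close> of the faces for some \<open>p\<close>. None of these faces
  contains 0, so the cone of \<open>p\<close> has full \<open>I_cone\<close> and empty
  \<open>J_cone\<close>, and Euler's relation contradicts nondegeneracy at \<open>a\<close>.\<close>

lemma K_infinity_empty:
  assumes "dual_subdivision supp C" "nondegenerate_at_infinity C supp face"
  shows "K_infinity F = {}"
proof (rule ccontr)
  assume "K_infinity F \<noteq> {}"
  then obtain c x where unbdd: "filterlim (\<lambda>l. norm (x l)) at_top sequentially"
    and lim: "(\<lambda>l. F (x l)) \<longlonglongrightarrow> c"
    unfolding K_infinity_def by blast
  have "\<exists>y. (\<forall>i. y $ i \<noteq> 0) \<and> dist y (x l) < 1 / real (Suc l) \<and> dist (F y) (F (x l)) < 1 / real (Suc l)" for l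
    by (rule perturb_nonzero) simp
  then obtain y where y: "\<And>l i. y l $ i \<noteq> 0" "\<And>l. dist (y l) (x l) < 1 / real (Suc l)"
    "\<And>l. dist (F (y l)) (F (x l)) < 1 / real (Suc l)"
    by metis
  \<comment> \<open>The perturbation moves each point by less than 1.\<close>
  have "filterlim (\<lambda>l. - 1 + norm (x l)) at_top sequentially"
    using tendsto_const unbdd by (rule filterlim_tendsto_add_at_top)
  moreover have "- 1 + norm (x l) \<le> norm (y l)" for l
  proof -
    have "1 / real (Suc l) \<le> 1" by simp
    then have "norm (x l - y l) \<le> 1"
      using y(2)[of l] unfolding dist_norm norm_minus_commute[of "y l"] by linarith
    then show ?thesis
      using norm_triangle_ineq2[of "x l" "y l"] by linarith
  qed
  ultimately have "filterlim (\<lambda>l. norm (y l)) at_top sequentially"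
    by (rule filterlim_at_top_mono[OF _ always_eventually[OF allI]])
  moreover have "(\<lambda>l. F (y l)) \<longlonglongrightarrow> c"
  proof -
    have "(\<lambda>l. F (y l) - F (x l)) \<longlonglongrightarrow> 0"
    proof (rule Lim_null_comparison)
      show "\<forall>\<^sub>F l in sequentially. norm (F (y l) - F (x l)) \<le> 1 / real (Suc l)"
        using y(3) unfolding dist_norm by (intro always_eventually allI less_imp_le)
      show "(\<lambda>l. 1 / real (Suc l)) \<longlonglongrightarrow> 0"
        using lim_1_over_n[where 'a = real, THEN LIMSEQ_Suc] by simp
    qed
    from tendsto_add[OF this lim] show ?thesis by simp
  qed
  ultimately obtain p a where p: "p \<in> dual_domain" and a: "\<And>i. a $ i \<noteq> 0"
    and zero: "\<And>j. face j (min_face (supp j) p) a = 0"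
    using face_zero_if_bounded_sequence[of y c] y(1) by blast
  obtain \<sigma> where \<sigma>: "\<sigma> \<in> C" "\<And>j. cone_face (supp j) \<sigma> = min_face (supp j) p"
    using dual_subdivision_cone_face[OF assms(1) p] by blast
  have notin: "0 \<notin> min_face (supp j) p" for j
    unfolding supp_def using p convenient_K zero_notin by (rule zero_notin_min_face)
  have I: "I_cone supp \<sigma> = UNIV"
    by (simp add: I_cone_def \<sigma>(2) notin)
  have J: "J_cone supp \<sigma> = {}"
    using notin by (auto simp: J_cone_def \<sigma>(2))
  have "a \<in> G_cone supp face \<sigma>"
    by (simp add: G_cone_def a \<sigma>(2) zero)
  moreover have "p \<noteq> 0"
    using p by (auto simp: dual_domain_def)
  then have "a \<in> Sing_family UNIV (\<lambda>j. face j (min_face (supp j) p))"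
    using a zero inner_eq_on_min_face by (rule Sing_family_face)
  moreover have "Sing_family (I_cone supp \<sigma>) (\<lambda>j. face j (cone_face (supp j) \<sigma>)) \<inter> G_cone supp face \<sigma> = {}"
    using assms(2)[unfolded nondegenerate_at_infinity_def, rule_format, OF \<sigma>(1)] I J by simp
  ultimately show False
    unfolding I \<sigma>(2) by blast
qed

lemma global_diffeomorphism_F:
  assumes "dual_subdivision supp C" "nondegenerate_at_infinity C supp face" "Sing F = {}"
  shows "global_diffeomorphism F"
  using C1_F assms(3) K_infinity_empty[OF assms(1,2)]
  by (rule global_diffeomorphism_if_Sing_K_infinity_empty)

end

section \<open>Polynomial maps\<close>

lemma vec_power_scaleR_exp:
  fixes x :: "'a::real_normed_field ^ 'n"
  shows "vec_power (\<chi> i. exp (t $ i) *\<^sub>R x $ i) \<nu> = exp (t \<bullet> real_vec \<nu>) *\<^sub>R vec_power x \<nu>"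
proof -
  have "exp (t \<bullet> real_vec \<nu>) = (\<Prod>i\<in>UNIV. exp (t $ i) ^ (\<nu> $ i))"
    by (simp add: inner_vec_def real_vec_def exp_sum exp_of_nat2_mult)
  then show ?thesis
    by (simp add: vec_power_def scaleR_conv_of_real power_mult_distrib prod.distrib)
qed

lemma vec_power_zero: "vec_power (0 :: 'a::comm_semiring_1 ^ 'n) \<nu> = (if \<nu> = 0 then 1 else 0)"
proof (cases "\<nu> = 0")
  case False
  then obtain i where "\<nu> $ i \<noteq> 0"
    by (auto simp: vec_eq_iff)
  then have "\<exists>i\<in>UNIV. (0::'a) ^ (\<nu> $ i) = 0"
    by (intro bexI[of _ i]) (simp_all add: zero_power)
  then show ?thesis
    using False unfolding vec_power_def by (simp add: prod_zero)
qed (simp add: vec_power_def)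

lemma C1_vec_power: "C1_map (\<lambda>x :: 'a::{real_normed_field, euclidean_space} ^ 'n. vec_power x \<nu>)"
  using C1_map_vec_power[of "\<lambda>i x. x $ i" \<nu>] by (simp add: C1_map_bounded_linear bounded_linear_vec_nth)

lemma C1_vec_power_cnj: "C1_map (\<lambda>z. vec_power (cnj_vec z) \<nu>)"
  unfolding cnj_vec_def
  by (intro C1_map_vec_power C1_map_bounded_linear bounded_linear_compose[OF bounded_linear_cnj bounded_linear_vec_nth])

lemma cnj_vec_scaleR: "cnj_vec (\<chi> i. r $ i *\<^sub>R z $ i) = (\<chi> i. r $ i *\<^sub>R cnj_vec z $ i)"
  by (simp add: cnj_vec_def vec_eq_iff)

text \<open>At the origin only the constant term survives; its vanishing keeps 0 out of the
  support.\<close>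

lemma lookup_zero_if_poly_map_zero:
  assumes "poly_map f 0 = 0"
  shows "Poly_Mapping.lookup (f j) 0 = 0"
proof -
  have "(\<Sum>\<nu>\<in>Poly_Mapping.keys (f j). Poly_Mapping.lookup (f j) \<nu> * vec_power 0 \<nu>) = 0"
    using arg_cong[OF assms, of "\<lambda>v. v $ j"] by (simp add: poly_map_def poly_eval_def)
  moreover have "Poly_Mapping.lookup (f j) \<nu> * vec_power 0 \<nu> =
      (if \<nu> = 0 then Poly_Mapping.lookup (f j) \<nu> else 0)" for \<nu>
    by (simp add: vec_power_zero)
  ultimately show ?thesis
    by (simp add: in_keys_iff split: if_splits)
qed

lemma lookup_zero_if_mixed_map_zero:
  assumes "mixed_map f 0 = 0"
  shows "Poly_Mapping.lookup (f j) (0, 0) = 0"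
proof -
  have cnj0: "cnj_vec 0 = 0"
    by (simp add: cnj_vec_def vec_eq_iff)
  have "(\<Sum>(\<nu>, \<mu>)\<in>Poly_Mapping.keys (f j).
      Poly_Mapping.lookup (f j) (\<nu>, \<mu>) * vec_power 0 \<nu> * vec_power (cnj_vec 0) \<mu>) = 0"
    using arg_cong[OF assms, of "\<lambda>v. v $ j"] by (simp add: mixed_map_def mixed_eval_def)
  moreover have "(case k of (\<nu>, \<mu>) \<Rightarrow>
      Poly_Mapping.lookup (f j) (\<nu>, \<mu>) * vec_power 0 \<nu> * vec_power (cnj_vec 0) \<mu>) =
      (if k = (0, 0) then Poly_Mapping.lookup (f j) k else 0)" for k
    by (cases k) (simp add: vec_power_zero cnj0)
  ultimately show ?thesis
    by (simp add: in_keys_iff split: if_splits)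
qed

text \<open>Real and complex coefficients are covered together. Terms are indexed by their
  exponents, so \<open>e\<close> is the identity.\<close>

lemma global_diffeomorphism_poly_map:
  fixes f :: "'n::finite \<Rightarrow> ('a::{real_normed_field, euclidean_space}, 'n) polynomial"
  assumes "dual_subdivision (\<lambda>j. poly_supp (f j)) C" "poly_map f 0 = 0" "Sing (poly_map f) = {}"
    and "poly_nondegenerate_at_infinity C f" and conv: "\<And>i. convenient (poly_supp (f i))"
  shows "global_diffeomorphism (poly_map f)"
proof -
  define m where "m j \<nu> x = Poly_Mapping.lookup (f j) \<nu> * vec_power x \<nu>" for j \<nu> and x :: "'a ^ 'n"
  have supp: "poly_supp (f j) = (\<lambda>\<nu>. \<nu>) ` Poly_Mapping.keys (f j)" for j
    by (auto simp: poly_supp_def in_keys_iff)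
  interpret quasihomogeneous_sums "\<lambda>j. Poly_Mapping.keys (f j)" "\<lambda>\<nu>. \<nu>" m
  proof
    show "C1_map (m j \<nu>)" for j \<nu>
      unfolding m_def[abs_def] by (rule C1_map_mult[OF C1_map_const C1_vec_power])
    show "m j \<nu> (\<chi> i. exp (t $ i) *\<^sub>R x $ i) = exp (t \<bullet> real_vec \<nu>) *\<^sub>R m j \<nu> x" for j \<nu> t x
      by (simp add: m_def vec_power_scaleR_exp)
    show "convenient ((\<lambda>\<nu>. \<nu>) ` Poly_Mapping.keys (f j))" for j
      using conv[of j] by (simp only: supp)
    show "0 \<notin> (\<lambda>\<nu>. \<nu>) ` Poly_Mapping.keys (f j)" for j
      using lookup_zero_if_poly_map_zero[OF assms(2)] by (simp add: in_keys_iff)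
  qed simp
  have "F = poly_map f"
    by (simp add: fun_eq_iff F_def poly_map_def poly_eval_def m_def)
  moreover have "face = (\<lambda>j. poly_face (f j))"
    by (simp add: fun_eq_iff face_def poly_face_def m_def)
  moreover have "local.supp = (\<lambda>j. poly_supp (f j))"
    by (rule ext) (simp only: supp_def supp)
  ultimately show ?thesis
    using global_diffeomorphism_F[of C] assms by (simp add: poly_nondegenerate_at_infinity_def)
qed

lemma global_diffeomorphism_mixed_map:
  fixes f :: "'n::finite \<Rightarrow> 'n mixed_polynomial"
  assumes "dual_subdivision (\<lambda>j. mixed_supp (f j)) C" "mixed_map f 0 = 0" "Sing (mixed_map f) = {}"
    and "mixed_nondegenerate_at_infinity C f" and conv: "\<And>i. convenient (mixed_supp (f i))"
  shows "global_diffeomorphism (mixed_map f)"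
proof -
  \<comment> \<open>A positive scaling acts on a coordinate and its conjugate alike, so the weight
    of a mixed term is the sum of its two exponents.\<close>
  define e :: "(nat ^ 'n) \<times> (nat ^ 'n) \<Rightarrow> nat ^ 'n" where "e = (\<lambda>(\<nu>, \<mu>). \<nu> + \<mu>)"
  define m where "m j = (\<lambda>(\<nu>, \<mu>) z.
    Poly_Mapping.lookup (f j) (\<nu>, \<mu>) * vec_power z \<nu> * vec_power (cnj_vec z) \<mu>)" for j
  have real_vec_add: "real_vec (\<nu> + \<mu>) = real_vec \<nu> + real_vec \<mu>" for \<nu> \<mu> :: "nat ^ 'n"
    by (simp add: real_vec_def vec_eq_iff)
  have supp: "mixed_supp (f j) = e ` Poly_Mapping.keys (f j)" for j
    by (force simp: mixed_supp_def e_def in_keys_iff)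
  interpret quasihomogeneous_sums "\<lambda>j. Poly_Mapping.keys (f j)" e m
  proof
    show "C1_map (m j k)" for j k
      by (cases k) (simp add: m_def C1_map_mult C1_map_const C1_vec_power C1_vec_power_cnj)
    show "m j k (\<chi> i. exp (t $ i) *\<^sub>R x $ i) = exp (t \<bullet> real_vec (e k)) *\<^sub>R m j k x" for j k t x
    proof (cases k)
      case (Pair \<nu> \<mu>)
      have "cnj_vec (\<chi> i. exp (t $ i) *\<^sub>R x $ i) = (\<chi> i. exp (t $ i) *\<^sub>R cnj_vec x $ i)"
        using cnj_vec_scaleR[of "\<chi> i. exp (t $ i)" x] by simp
      then show ?thesis
        by (simp add: Pair m_def e_def vec_power_scaleR_exp real_vec_add inner_add_right exp_add)
    qed
    show "convenient (e ` Poly_Mapping.keys (f j))" for j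
      using conv[of j] by (simp only: supp)
    show "0 \<notin> e ` Poly_Mapping.keys (f j)" for j
    proof
      assume "0 \<in> e ` Poly_Mapping.keys (f j)"
      then obtain \<nu> \<mu> where k: "(\<nu>, \<mu>) \<in> Poly_Mapping.keys (f j)" "\<nu> + \<mu> = 0"
        by (auto simp: e_def)
      \<comment> \<open>Exponents are natural numbers, so only the constant term has total exponent
        0.\<close>
      then have "\<nu> = 0" "\<mu> = 0"
        by (simp_all add: vec_eq_iff)
      then show False
        using k(1) lookup_zero_if_mixed_map_zero[OF assms(2), of j] by (simp add: in_keys_iff)
    qed
  qed simp
  have "F = mixed_map f"
    by (simp add: fun_eq_iff F_def mixed_map_def mixed_eval_def m_def case_prod_unfold)
  moreover have "face = (\<lambda>j. mixed_face (f j))"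
    by (intro ext, unfold face_def mixed_face_def) (simp add: m_def e_def case_prod_unfold)
  moreover have "local.supp = (\<lambda>j. mixed_supp (f j))"
    by (rule ext) (simp only: supp_def supp)
  ultimately show ?thesis
    using global_diffeomorphism_F[of C] assms by (simp add: mixed_nondegenerate_at_infinity_def)
qed

theorem theorem1p4:
  shows
    "((\<forall>F :: real ^ 'n \<Rightarrow> real ^ 'n.
         C1_map F \<longrightarrow> semialgebraic_map F \<longrightarrow> Sing F = {} \<longrightarrow> K_infinity F = {} \<longrightarrow>
         global_diffeomorphism F) \<and>
      (\<forall>F :: complex ^ 'n \<Rightarrow> complex ^ 'n.
         C1_map F \<longrightarrow> semialgebraic_map F \<longrightarrow> Sing F = {} \<longrightarrow> K_infinity F = {} \<longrightarrow>
         global_diffeomorphism F)) \<and>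
     ((\<forall>(f :: 'n \<Rightarrow> (real, 'n) polynomial) C.
         dual_subdivision (\<lambda>j. poly_supp (f j)) C \<longrightarrow>
         poly_map f 0 = 0 \<longrightarrow> Sing (poly_map f) = {} \<longrightarrow>
         poly_nondegenerate_at_infinity C f \<longrightarrow>
         (\<forall>i. convenient (poly_supp (f i))) \<longrightarrow>
         global_diffeomorphism (poly_map f)) \<and>
      (\<forall>(f :: 'n \<Rightarrow> 'n mixed_polynomial) C.
         dual_subdivision (\<lambda>j. mixed_supp (f j)) C \<longrightarrow>
         mixed_map f 0 = 0 \<longrightarrow> Sing (mixed_map f) = {} \<longrightarrow>
         mixed_nondegenerate_at_infinity C f \<longrightarrow>
         (\<forall>i. convenient (mixed_supp (f i))) \<longrightarrow>
         global_diffeomorphism (mixed_map f)) \<and>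
      (\<forall>(f :: 'n \<Rightarrow> (complex, 'n) polynomial) C.
         dual_subdivision (\<lambda>j. poly_supp (f j)) C \<longrightarrow>
         poly_map f 0 = 0 \<longrightarrow> Sing (poly_map f) = {} \<longrightarrow>
         poly_nondegenerate_at_infinity C f \<longrightarrow>
         (\<forall>i. convenient (poly_supp (f i))) \<longrightarrow>
         global_diffeomorphism (poly_map f)))"
  by (intro conjI allI impI global_diffeomorphism_if_Sing_K_infinity_empty global_diffeomorphism_poly_map
      global_diffeomorphism_mixed_map) simp_all

end
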